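(* Let $a\in\mathbb{R}$, $\lambda\in[0,1)$, and let $f=h+\overline{g}$, where $h,g$ are analytic in $\mathbb{D}$ with $h(0)=g(0)=0$, $h-g=k_a$ and $g'/h'=\lambda z$ in $\mathbb{D}$. For $0<r<1$ let $\mathcal{A}(f(\mathbb{D}_r))$ denote the area of $f(\mathbb{D}_r)$, $\mathbb{D}_r=\{|z|<r\}$. Then $$2\pi\int_0^r\frac{(\rho-\lambda^2\rho^3)(1-\rho)^{2(a-1)}}{(1+\lambda\rho)^2(1+\rho)^{2(a+1)}}\,d\rho\le\mathcal{A}(f(\mathbb{D}_r))\le2\pi\int_0^r\frac{(\rho-\lambda^2\rho^3)(1+\rho)^{2(a-1)}}{(1-\lambda\rho)^2(1-\rho)^{2(a+1)}}\,d\rho\quad\text{if } a\ge1,$$ $$2\pi\int_0^r\frac{\rho-\lambda^2\rho^3}{(1+\lambda\rho)^2(1+\rho)^{4}}\,d\rho\le\mathcal{A}(f(\mathbb{D}_r))\le2\pi\int_0^r\frac{\rho-\lambda^2\rho^3}{(1-\lambda\rho)^2(1-\rho)^{4}}\,d\rho\quad\text{if } -1<a<1,$$ $$2\pi\int_0^r\frac{(\rho-\lambda^2\rho^3)(1+\rho)^{2(a-1)}}{(1+\lambda\rho)^2(1-\rho)^{2(a+1)}}\,d\rho\le\mathcal{A}(f(\mathbb{D}_r))\le2\pi\int_0^r\frac{(\rho-\lambda^2\rho^3)(1-\rho)^{2(a-1)}}{(1-\lambda\rho)^2(1+\rho)^{2(a+1)}}\,d\rho\quad\text{if } a\le-1.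$$
   Context: $\mathbb{D}$ is the open unit disk. For $a\neq0$, $k_a(z)=\frac{1}{2a}\left[\left(\frac{1+z}{1-z}\right)^a-1\right]$ (principal branch), and $k_0(z)=\frac12\log\frac{1+z}{1-z}$. *)

theory Defs
  imports "HOL-Complex_Analysis.Complex_Analysis"
begin

definition kfun :: "real \<Rightarrow> complex \<Rightarrow> complex" where
  "kfun a z = (if a = 0 then (1/2) * Ln ((1 + z) / (1 - z))
               else (1 / (2 * of_real a)) * (((1 + z) / (1 - z)) powr (of_real a) - 1))"

definition area :: "complex set \<Rightarrow> real" where
  "area S = measure lborel S"

end

theory Submission
  imports Defs
begin

text \<open>
  Put \<open>b = max 1 \<bar>a\<bar>\<close>. The Jacobian of \<open>f\<close> is \<open>\<bar>h'\<bar>\<^sup>2 - \<bar>g'\<bar>\<^sup>2\<close> with \<open>h' = k\<^sub>a' / (1 - \<lambda>z)\<close>,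
  and \<open>\<bar>1 \<plusminus> z\<bar>\<close>, \<open>\<bar>1 - \<lambda>z\<bar>\<close> are estimated by \<open>\<rho> = \<bar>z\<bar>\<close>; all three cases of the theorem
  are instances of one radial estimate in terms of \<open>b\<close>. Integrating it gives the upper bound for every
  \<open>a\<close>, since the area of an image never exceeds the integral of the Jacobian.

  The lower bound needs injectivity. As \<open>f = k\<^sub>a + 2 Re g\<close>, \<open>f\<close> is a horizontal shear of \<open>k\<^sub>a\<close>,
  hence injective wherever \<open>\<bar>a Arg ((1 + z) / (1 - z))\<bar> < \<pi>\<close>, a region which \<open>k\<^sub>a\<close> maps onto a
  horizontally convex domain. For \<open>\<bar>a\<bar> \<le> 2\<close> this is the whole disc. For \<open>\<bar>a\<bar> > 2\<close> the map \<open>f\<close> is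
  not injective on large discs, but it is on the disc of radius \<open>1 / (2 \<bar>a\<bar>)\<close>, and the image of that
  disc alone already has at least the area required for \<open>r = 1\<close>.
\<close>

section \<open>The functions \<open>k\<^sub>a\<close> in strip coordinates\<close>

lemma Im_Ln_upper_half_plane:
  assumes "Im z > 0"
  shows "Im (Ln z) = pi / 2 - arctan (Re z / Im z)"
proof -
  \<comment> \<open>Rotation by \<open>- \<i>\<close> takes the upper half-plane to the right
    half-plane, where the argument is an arctangent. Rotating back adds \<open>pi / 2\<close>
    without crossing the branch cut.\<close>
  define v where "v = - \<i> * z"
  have v: "z = \<i> * v" "Re v = Im z" "Im v = - Re z" by (simp_all add: v_def)
  have "v \<noteq> 0" using assms v(2) by auto
  have "Im (Ln z) = Im (Ln v) + pi / 2"
    unfolding v(1) using assms v(2) by (simp add: Ln_times_ii[OF \<open>v \<noteq> 0\<close>])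
  also have "Im (Ln v) = arctan (- (Re z / Im z))"
    using assms by (subst Im_Ln_eq[OF \<open>v \<noteq> 0\<close>]) (simp add: v(2,3))
  finally show ?thesis by (simp add: arctan_minus)
qed

text \<open>At fixed positive height the argument decreases as the real part grows, so on a
  horizontal segment it is largest at the left end. The maximum avoids deciding which endpoint that
  is.\<close>

lemma Im_Ln_le_max_segment:
  assumes y: "Im z > 0" "Im z1 = Im z" "Im z2 = Im z"
    and x: "Re z \<in> closed_segment (Re z1) (Re z2)"
  shows "Im (Ln z) \<le> max (Im (Ln z1)) (Im (Ln z2))"
proof -
  have "Re z1 \<le> Re z \<or> Re z2 \<le> Re z"
    using x by (auto simp: closed_segment_eq_real_ivl split: if_splits)
  then have "arctan (Re z1 / Im z) \<le> arctan (Re z / Im z) \<or> arctan (Re z2 / Im z) \<le> arctan (Re z / Im z)"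
    using y by (auto simp: arctan_le_iff divide_right_mono)
  then show ?thesis using y by (auto simp: Im_Ln_upper_half_plane)
qed

text \<open>A sector of half-angle above \<open>pi / 2\<close> is not convex, but it still contains
  every horizontal segment with endpoints in it. Above the real axis this is the preceding lemma,
  below it the same lemma after conjugation. On the axis itself, endpoints off the slit are
  positive, and so is everything between them.\<close>

lemma sector_horizontally_convex:
  assumes z1: "z1 \<notin> \<real>\<^sub>\<le>\<^sub>0" and z2: "z2 \<notin> \<real>\<^sub>\<le>\<^sub>0"
    and y: "Im z1 = Im z" "Im z2 = Im z"
    and x: "Re z \<in> closed_segment (Re z1) (Re z2)"
    and th: "\<bar>Im (Ln z1)\<bar> < \<theta>" "\<bar>Im (Ln z2)\<bar> < \<theta>"
  shows "z \<notin> \<real>\<^sub>\<le>\<^sub>0 \<and> \<bar>Im (Ln z)\<bar> < \<theta>"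
proof -
  consider "Im z > 0" | "Im z < 0" | "Im z = 0" by linarith
  then show ?thesis
  proof cases
    case 1
    have "Im (Ln z) \<le> max (Im (Ln z1)) (Im (Ln z2))"
      by (rule Im_Ln_le_max_segment) (use 1 y x in auto)
    with 1 th Im_Ln_pos_lt_imp[OF 1] show ?thesis by (auto simp: complex_nonpos_Reals_iff)
  next
    case 2
    have nz: "z \<notin> \<real>\<^sub>\<le>\<^sub>0" using 2 by (auto simp: complex_nonpos_Reals_iff)
    have "Im (Ln (cnj z)) \<le> max (Im (Ln (cnj z1))) (Im (Ln (cnj z2)))"
      by (rule Im_Ln_le_max_segment) (use 2 y x in auto)
    with nz z1 z2 have "- Im (Ln z) \<le> max (- Im (Ln z1)) (- Im (Ln z2))"
      by (simp flip: cnj_Ln)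
    moreover have "- Im (Ln z) > 0"
      using Im_Ln_pos_lt_imp[of "cnj z"] 2 nz by (simp flip: cnj_Ln)
    ultimately show ?thesis using th nz by auto
  next
    case 3
    with y z1 z2 have "Re z1 > 0" "Re z2 > 0" by (auto simp: complex_nonpos_Reals_iff)
    with x have "Re z > 0" by (auto simp: closed_segment_eq_real_ivl split: if_splits)
    moreover have "Im (Ln z) = 0" using \<open>Re z > 0\<close> 3 Im_Ln_eq_0[of z] by fastforce
    ultimately show ?thesis using th 3 by (auto simp: complex_nonpos_Reals_iff)
  qed
qed

section \<open>The unit disc as the strip |Im u| < pi/2\<close>

definition strip_log :: "complex \<Rightarrow> complex" where
  "strip_log z = Ln (1 + z) - Ln (1 - z)"

text \<open>This is tanh (u/2), the conformal map from the strip back to the disc.\<close>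

definition strip_exp :: "complex \<Rightarrow> complex" where
  "strip_exp u = (exp u - 1) / (exp u + 1)"

lemma Re_one_pm_pos:
  assumes "cmod z < 1"
  shows "Re (1 + z) > 0" "Re (1 - z) > 0" "1 + z \<noteq> 0" "1 - z \<noteq> 0"
    "1 + z \<notin> \<real>\<^sub>\<le>\<^sub>0" "1 - z \<notin> \<real>\<^sub>\<le>\<^sub>0" "z \<noteq> 1"
proof -
  show "Re (1 + z) > 0" "Re (1 - z) > 0"
    using abs_Re_le_cmod[of z] assms by auto
  then show "1 + z \<noteq> 0" "1 - z \<noteq> 0" "1 + z \<notin> \<real>\<^sub>\<le>\<^sub>0" "1 - z \<notin> \<real>\<^sub>\<le>\<^sub>0" "z \<noteq> 1"
    by (auto simp: complex_nonpos_Reals_iff complex_eq_iff)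
qed

lemma exp_strip_log: "cmod z < 1 \<Longrightarrow> exp (strip_log z) = (1 + z) / (1 - z)"
  by (simp add: strip_log_def exp_diff Re_one_pm_pos)

text \<open>Applied to \<open>z\<close>, this puts \<open>strip_log z\<close> into the strip.
  Applied to \<open>of_real lam * z\<close>, it is the positivity that makes \<open>Re f\<close>
  monotone along lifted horizontal segments.\<close>

lemma Re_cayley_pos:
  assumes "cmod z < 1"
  shows "Re ((1 + z) / (1 - z)) > 0"
proof -
  have "Re ((1 + z) / (1 - z)) = (1 - (cmod z)\<^sup>2) / (cmod (1 - z))\<^sup>2"
    unfolding Re_divide cmod_power2 by (simp add: power2_eq_square algebra_simps)
  with assms show ?thesis by (simp add: Re_one_pm_pos power_less_one_iff)
qed

text \<open>Both \<open>1 + z\<close> and \<open>1 - z\<close> lie in the right half-plane, so each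
  logarithm has imaginary part below \<open>pi / 2\<close> in modulus and their difference stays in
  the principal range.\<close>

lemma strip_log_eq_Ln:
  assumes "cmod z < 1"
  shows "strip_log z = Ln ((1 + z) / (1 - z))"
proof (rule Ln_unique[symmetric])
  have "\<bar>Im (strip_log z)\<bar> < pi"
    unfolding strip_log_def
    using Re_Ln_pos_lt_imp[OF Re_one_pm_pos(1)[OF assms]] Re_Ln_pos_lt_imp[OF Re_one_pm_pos(2)[OF assms]]
    by (simp only: minus_complex.sel)
  then show "- pi < Im (strip_log z)" "Im (strip_log z) \<le> pi" by linarith+
qed (rule exp_strip_log[OF assms])

lemma Im_strip_log:
  assumes "cmod z < 1"
  shows "\<bar>Im (strip_log z)\<bar> < pi / 2"
  using Re_Ln_pos_lt_imp[OF Re_cayley_pos[OF assms]] by (simp add: strip_log_eq_Ln assms)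

lemma Re_strip_log: "cmod z < 1 \<Longrightarrow> Re (strip_log z) = ln (cmod (1 + z)) - ln (cmod (1 - z))"
  by (simp add: strip_log_def Re_one_pm_pos)

lemma strip_exp_log:
  assumes "cmod z < 1"
  shows "strip_exp (strip_log z) = z"
proof -
  have "exp (strip_log z) + 1 = 2 / (1 - z)" "exp (strip_log z) - 1 = 2 * z / (1 - z)"
    using Re_one_pm_pos(7)[OF assms] by (simp_all add: exp_strip_log assms field_simps)
  then show ?thesis using Re_one_pm_pos(7)[OF assms] by (simp add: strip_exp_def)
qed

lemma strip_exp:
  assumes "\<bar>Im u\<bar> < pi / 2"
  shows "exp u + 1 \<noteq> 0" "cmod (strip_exp u) < 1" "strip_log (strip_exp u) = u"
proof -
  have pos: "Re (exp u) > 0"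
    using assms by (simp add: Re_exp cos_gt_zero_pi abs_less_iff)
  then show nz: "exp u + 1 \<noteq> 0" by (auto simp: complex_eq_iff)
  \<comment> \<open>A point with positive real part is closer to 1 than to -1.\<close>
  have "(cmod (exp u - 1))\<^sup>2 < (cmod (exp u + 1))\<^sup>2"
    unfolding cmod_power2 using pos by (simp add: power2_eq_square algebra_simps)
  then have "cmod (exp u - 1) < cmod (exp u + 1)"
    using power2_less_imp_less norm_ge_zero by blast
  with nz show lt: "cmod (strip_exp u) < 1"
    by (simp add: strip_exp_def norm_divide)
  have "1 + strip_exp u = 2 * exp u / (exp u + 1)" "1 - strip_exp u = 2 / (exp u + 1)"
    using nz by (simp_all add: strip_exp_def field_simps)
  then have "(1 + strip_exp u) / (1 - strip_exp u) = exp u"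
    using nz by simp
  then show "strip_log (strip_exp u) = u"
    using assms by (simp add: strip_log_eq_Ln lt)
qed

lemma has_field_derivative_strip_log:
  assumes "cmod z < 1"
  shows "(strip_log has_field_derivative 2 / ((1 + z) * (1 - z))) (at z)"
proof -
  note nz = Re_one_pm_pos[OF assms]
  have "(strip_log has_field_derivative (inverse (1 + z) * 1 - inverse (1 - z) * (- 1))) (at z)"
    unfolding strip_log_def[abs_def]
    by (rule DERIV_diff; rule DERIV_chain2[OF has_field_derivative_Ln])
       (use nz in \<open>auto intro!: derivative_eq_intros\<close>)
  then show ?thesis using nz by (simp add: field_simps)
qed

lemma has_field_derivative_strip_exp:
  assumes "\<bar>Im u\<bar> < pi / 2"
  shows "(strip_exp has_field_derivative 2 * exp u / (exp u + 1)\<^sup>2) (at u)"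
proof -
  have "(strip_exp has_field_derivative
      (exp u * (exp u + 1) - (exp u - 1) * exp u) / ((exp u + 1) * (exp u + 1))) (at u)"
    unfolding strip_exp_def[abs_def]
    by (rule DERIV_divide) (use strip_exp(1)[OF assms] in \<open>auto intro!: derivative_eq_intros\<close>)
  then show ?thesis by (simp add: power2_eq_square algebra_simps)
qed

section \<open>The derivative of \<open>kfun\<close> and its modulus\<close>

lemma kfun_strip_log:
  assumes "cmod z < 1"
  shows "kfun a z = (if a = 0 then strip_log z / 2
           else (exp (of_real a * strip_log z) - 1) / (2 * of_real a))"
proof -
  have "(1 + z) / (1 - z) \<noteq> 0" using Re_one_pm_pos[OF assms] by simp
  then show ?thesis unfolding kfun_def strip_log_eq_Ln[OF assms] by (simp add: powr_def)
qed

text \<open>One formula serves \<open>a = 0\<close> too: differentiating the exponential cancels the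
  factor 1/a.\<close>

definition kfun' :: "real \<Rightarrow> complex \<Rightarrow> complex" where
  "kfun' a z = exp (of_real a * strip_log z) / ((1 + z) * (1 - z))"

lemma has_field_derivative_kfun:
  assumes "cmod z < 1"
  shows "(kfun a has_field_derivative kfun' a z) (at z)"
proof -
  let ?k = "\<lambda>z. if a = 0 then strip_log z / 2
           else (exp (of_real a * strip_log z) - 1) / (2 * of_real a)"
  have "(?k has_field_derivative kfun' a z) (at z)"
  proof (cases "a = 0")
    case True
    have "((\<lambda>z. strip_log z / 2) has_field_derivative (2 / ((1 + z) * (1 - z))) / 2) (at z)"
      by (rule DERIV_cdivide[OF has_field_derivative_strip_log[OF assms]])
    with True show ?thesis by (simp add: kfun'_def)
  next
    case False
    have "((\<lambda>z. (exp (of_real a * strip_log z) - 1) / (2 * of_real a)) has_field_derivative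
        (exp (of_real a * strip_log z) * (of_real a * (2 / ((1 + z) * (1 - z)))) - 0) / (2 * of_real a)) (at z)"
      by (intro DERIV_cdivide DERIV_diff DERIV_chain2[OF DERIV_exp] DERIV_cmult DERIV_const
            has_field_derivative_strip_log[OF assms])
    moreover have "(exp (of_real a * strip_log z) * (of_real a * (2 / ((1 + z) * (1 - z)))) - 0) / (2 * of_real a)
        = kfun' a z"
    proof -
      have "(E * (A * (2 / D)) - 0) / (2 * A) = E / D" if "A \<noteq> 0" for E A D :: complex
        using that by (simp add: field_simps)
      then show ?thesis unfolding kfun'_def using False of_real_eq_0_iff by blast
    qed
    ultimately show ?thesis using False by simp
  qed
  then show ?thesis
  proof (rule has_field_derivative_transform_within_open[of _ _ _ "ball 0 1"])
    show "\<And>z. z \<in> ball 0 1 \<Longrightarrow> ?k z = kfun a z" by (simp add: kfun_strip_log)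
  qed (use assms in auto)
qed

lemma norm_kfun':
  assumes "cmod z < 1"
  shows "(cmod (kfun' a z))\<^sup>2 = cmod (1 + z) powr (2 * (a - 1)) / cmod (1 - z) powr (2 * (a + 1))"
proof -
  have p: "cmod (1 + z) > 0" "cmod (1 - z) > 0" using Re_one_pm_pos[OF assms] by simp_all
  define x y where "x = cmod (1 + z)" and "y = cmod (1 - z)"
  have "cmod (kfun' a z) = exp (a * (ln x - ln y)) / (x * y)"
    unfolding kfun'_def by (simp add: norm_divide norm_mult Re_strip_log assms x_def y_def)
  also have "\<dots> = exp (a * (ln x - ln y) - (ln x + ln y))"
    using p unfolding exp_diff exp_add x_def y_def by simp
  also have "a * (ln x - ln y) - (ln x + ln y) = (a - 1) * ln x - (a + 1) * ln y"
    by (simp add: algebra_simps)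
  finally have "(cmod (kfun' a z))\<^sup>2 = exp (2 * ((a - 1) * ln x - (a + 1) * ln y))"
    by (metis exp_double)
  also have "\<dots> = x powr (2 * (a - 1)) / y powr (2 * (a + 1))"
    using p unfolding right_diff_distrib exp_diff by (simp add: powr_def x_def y_def algebra_simps)
  finally show ?thesis by (simp add: x_def y_def)
qed

section \<open>Area and radial integrals in the complex plane\<close>

definition vec2 :: "complex \<Rightarrow> real^2" where
  "vec2 z = vector [Re z, Im z]"

definition cpx2 :: "real^2 \<Rightarrow> complex" where
  "cpx2 x = Complex (x $ 1) (x $ 2)"

lemma vec2_nth [simp]: "vec2 z $ 1 = Re z" "vec2 z $ 2 = Im z"
  by (simp_all add: vec2_def)

lemma Re_cpx2 [simp]: "Re (cpx2 x) = x $ 1" and Im_cpx2 [simp]: "Im (cpx2 x) = x $ 2"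
  by (simp_all add: cpx2_def)

lemma vec2_cpx2 [simp]: "vec2 (cpx2 x) = x"
  by (simp add: vec_eq_iff forall_2)

lemma cpx2_vec2 [simp]: "cpx2 (vec2 z) = z"
  by (simp add: complex_eq_iff)

lemma bounded_linear_vec2: "bounded_linear vec2"
  by (rule linear_conv_bounded_linear[THEN iffD1], rule linearI) (simp_all add: vec_eq_iff forall_2)

lemma bounded_linear_cpx2: "bounded_linear cpx2"
  by (rule linear_conv_bounded_linear[THEN iffD1], rule linearI) (simp_all add: complex_eq_iff)

lemma measurable_cpx2 [measurable]: "cpx2 \<in> borel_measurable borel"
  using bounded_linear.continuous_on[OF bounded_linear_cpx2 continuous_on_id]
  by (rule borel_measurable_continuous_onI)

text \<open>Lebesgue measure is determined by its values on boxes, and the preimage of a box under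
  \<open>cpx2\<close> is the box with the same side lengths.\<close>

lemma distr_lborel_cpx2: "distr lborel borel cpx2 = lborel"
proof (rule lborel_eqI[symmetric])
  fix l u :: complex
  assume le: "\<And>b. b \<in> Basis \<Longrightarrow> l \<bullet> b \<le> u \<bullet> b"
  have le': "\<And>i. vec2 l $ i \<le> vec2 u $ i"
    using le[of 1] le[of \<i>] by (metis exhaust_2 vec2_nth complex_Basis_1 complex_Basis_i complex_inner_1_right complex_inner_i_right)
  have eq: "cpx2 -` box l u = box (vec2 l) (vec2 u)"
    by (auto simp: box_def Basis_complex_def mem_box_cart forall_2 Basis_vec_def inner_axis cpx2_def)
  have "emeasure (distr lborel borel cpx2) (box l u) = emeasure lborel (box (vec2 l) (vec2 u))"
    by (simp add: emeasure_distr eq)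
  also have "\<dots> = ennreal ((Re u - Re l) * (Im u - Im l))"
    using le'[of 1] le'[of 2] by (auto simp: emeasure_lborel_box_eq Basis_vec_def UNIV_2 inner_axis axis_eq_axis  inner_diff_left)
  finally show "emeasure (distr lborel borel cpx2) (box l u) = (\<Prod>b\<in>Basis. (u - l) \<bullet> b)"
    by (simp add: Basis_complex_def)
qed simp

text \<open>With p = h' and q = g' this is the Jacobian of the harmonic map h + cnj g.\<close>

lemma det_vec2_conj:
  "det (matrix (\<lambda>x. vec2 (p * cpx2 x + cnj (q * cpx2 x)))) = (cmod p)\<^sup>2 - (cmod q)\<^sup>2"
  unfolding det_2 matrix_def cmod_power2
  by (simp add: axis_def power2_eq_square algebra_simps)

section \<open>Areas of images under planar maps with derivative p v + cnj (q v)\<close>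

locale planar_jacobian =
  fixes f p q :: "complex \<Rightarrow> complex" and S :: "complex set" and J :: "complex \<Rightarrow> real"
  assumes S: "S \<in> sets borel" and fS: "f ` S \<in> sets borel"
    and deriv: "\<And>z. z \<in> S \<Longrightarrow> (f has_derivative (\<lambda>v. p z * v + cnj (q z * v))) (at z)"
    and J: "\<And>z. z \<in> S \<Longrightarrow> J z = \<bar>(cmod (p z))\<^sup>2 - (cmod (q z))\<^sup>2\<bar>"
    and int: "set_integrable lborel S J"
begin

definition F :: "real^2 \<Rightarrow> real^2" where "F x = vec2 (f (cpx2 x))"
definition F' :: "real^2 \<Rightarrow> real^2 \<Rightarrow> real^2"
  where "F' x v = vec2 (p (cpx2 x) * cpx2 v + cnj (q (cpx2 x) * cpx2 v))"
definition T :: "(real^2) set" where "T = cpx2 -` S"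

lemma T_borel: "T \<in> sets borel"
  unfolding T_def using measurable_sets[OF measurable_cpx2 S] by simp

lemma F_deriv: "x \<in> T \<Longrightarrow> (F has_derivative F' x) (at x within T)"
  unfolding F_def F'_def T_def
  by (rule has_derivative_at_withinI, rule bounded_linear.has_derivative[OF bounded_linear_vec2])
     (use has_derivative_compose[OF bounded_linear.has_derivative[OF bounded_linear_cpx2 has_derivative_ident] deriv, of x] in simp)

lemma jac: "x \<in> T \<Longrightarrow> \<bar>det (matrix (F' x))\<bar> = J (cpx2 x)"
  unfolding F'_def T_def by (simp add: det_vec2_conj J del: complex_cnj_mult)

lemma F_image: "F ` T = cpx2 -` (f ` S)"
proof (intro set_eqI iffI)
  fix y assume "y \<in> cpx2 -` (f ` S)"
  then obtain z where z: "z \<in> S" "cpx2 y = f z" by auto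
  then have "y = F (vec2 z)" "vec2 z \<in> T" by (metis F_def cpx2_vec2 vec2_cpx2) (simp add: T_def z)
  then show "y \<in> F ` T" by blast
qed (auto simp: F_def T_def)

lemma measure_F_image: "measure lebesgue (F ` T) = area (f ` S)"
proof -
  have "cpx2 -` (f ` S) \<in> sets borel"
    using measurable_sets[OF measurable_cpx2 fS] by simp
  then have "measure lebesgue (F ` T) = measure lborel (cpx2 -` (f ` S))"
    unfolding F_image by (simp add: measure_completion)
  also have "\<dots> = measure (distr lborel borel cpx2) (f ` S)"
    using fS by (subst measure_distr) auto
  finally show ?thesis by (simp add: distr_lborel_cpx2 area_def)
qed

lemma int_F: "(\<lambda>x. \<bar>det (matrix (F' x))\<bar>) integrable_on T"
  and integral_F: "integral T (\<lambda>x. \<bar>det (matrix (F' x))\<bar>) = (LINT z:S|lborel. J z)"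
proof -
  have m: "(\<lambda>z. indicator S z *\<^sub>R J z) \<in> borel_measurable borel"
    using borel_measurable_integrable[OF int[unfolded set_integrable_def]] by simp
  have ind: "indicator S (cpx2 x) = indicator T x" for x
    by (simp add: T_def indicator_def)
  have "integrable (distr lborel borel cpx2) (\<lambda>z. indicator S z *\<^sub>R J z)"
    using int by (simp add: distr_lborel_cpx2 set_integrable_def)
  then have i: "set_integrable lborel T (\<lambda>x. J (cpx2 x))"
    using integrable_distr[of cpx2 lborel borel "\<lambda>z. indicator S z *\<^sub>R J z"]
    by (simp add: set_integrable_def ind)
  have "(LINT z:S|lborel. J z) = (\<integral>z. indicator S z *\<^sub>R J z \<partial>distr lborel borel cpx2)"
    by (simp add: distr_lborel_cpx2 set_lebesgue_integral_def)
  also have "\<dots> = (LINT x:T|lborel. J (cpx2 x))"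
    using m by (simp add: integral_distr set_lebesgue_integral_def ind)
  also have "\<dots> = integral T (\<lambda>x. J (cpx2 x))"
    by (rule set_borel_integral_eq_integral(2)[OF i])
  finally show "integral T (\<lambda>x. \<bar>det (matrix (F' x))\<bar>) = (LINT z:S|lborel. J z)"
    using jac by (simp cong: integral_cong)
  show "(\<lambda>x. \<bar>det (matrix (F' x))\<bar>) integrable_on T"
    using set_borel_integral_eq_integral(1)[OF i] jac by (simp cong: integrable_cong)
qed

text \<open>Points covered several times count once in the area and with multiplicity in the
  integral, so injectivity is not assumed here.\<close>

lemma area_image_le: "area (f ` S) \<le> (LINT z:S|lborel. J z)"
  using measure_differentiable_image[OF _ F_deriv int_F] T_borel
  by (simp add: measure_F_image integral_F)

lemma area_image_eq:
  assumes "inj_on f S"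
  shows "area (f ` S) = (LINT z:S|lborel. J z)"
proof -
  have "inj_on F T"
  proof (rule inj_onI)
    fix x y assume *: "x \<in> T" "y \<in> T" "F x = F y"
    then have "f (cpx2 x) = f (cpx2 y)" by (metis F_def cpx2_vec2)
    with * assms have "cpx2 x = cpx2 y" by (auto simp: T_def inj_on_def)
    then show "x = y" by (metis vec2_cpx2)
  qed
  then show ?thesis
    using measure_differentiable_image_eq[OF _ F_deriv _ int_F] T_borel
    by (simp add: measure_F_image integral_F)
qed

end

section \<open>Integration of radial functions over discs\<close>

lemma distr_lborel_cmod:
  "distr (lborel :: complex measure) borel cmod = density lborel (\<lambda>x. ennreal (max 0 (2 * pi * x)))"
  (is "?M = ?N")
proof (rule measure_eqI_generator_eq)
  \<comment> \<open>It suffices to compare both measures on the half-lines \<open>{..<t}\<close>.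
    Their preimages under \<open>cmod\<close> are discs, whose area pi t^2 is the integral of 2 pi x
    over [0, t].\<close>
  let ?E = "range (\<lambda>a::real. {..<a})"
  show "Int_stable ?E"
  proof -
    have "{..<a} \<inter> {..<b} = {..<min a b}" for a b :: real by auto
    then show ?thesis by (auto simp: Int_stable_def)
  qed
  show "?E \<subseteq> Pow UNIV" by simp
  show "sets ?M = sigma_sets UNIV ?E" "sets ?N = sigma_sets UNIV ?E"
    by (simp_all add: borel_eq_lessThan eucl_less_def flip: lessThan_def)
  show "range (\<lambda>n. {..<real n}) \<subseteq> ?E" by auto
  show "(\<Union>n. {..<real n}) = UNIV" using reals_Archimedean2 by auto
  have M: "emeasure ?M {..<t} = emeasure lborel (ball (0::complex) t)" for t
    by (subst emeasure_distr) (auto simp: ball_def intro!: arg_cong2[where f=emeasure])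
  show "emeasure ?M {..<real n} \<noteq> \<infinity>" for n
    unfolding M using emeasure_lborel_ball_finite[of "0::complex" "real n"] by simp
  fix X assume "X \<in> ?E"
  then obtain t where X: "X = {..<t}" by auto
  show "emeasure ?M X = emeasure ?N X"
  proof (cases "t \<le> 0")
    case True
    have "AE x in lborel. ennreal (max 0 (2 * pi * x)) * indicator {..<t} x = 0"
      using True by (intro AE_I2) (auto simp: indicator_def max_def mult_le_0_iff zero_le_mult_iff not_le dest: pi_gt_zero[THEN not_le[THEN iffD2], THEN notE])
    then have "emeasure ?N X = 0"
      unfolding X by (subst emeasure_density) (auto simp: nn_integral_0_iff_AE)
    with True show ?thesis by (simp add: X M ball_empty)
  next
    case False
    have "emeasure ?N X = (\<integral>\<^sup>+x. ennreal (max 0 (2 * pi * x)) * indicator {..<t} x \<partial>lborel)"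
      unfolding X by (subst emeasure_density) auto
    also have "\<dots> = (\<integral>\<^sup>+x. ennreal (2 * pi * x) * indicator {0..t} x \<partial>lborel)"
    proof (rule nn_integral_cong_AE)
      \<comment> \<open>The fundamental theorem is applied on a closed interval; the added endpoint
        \<open>t\<close> is a null set.\<close>
      show "AE x in lborel. ennreal (max 0 (2 * pi * x)) * indicator {..<t} x = ennreal (2 * pi * x) * indicator {0..t} x"
        using AE_lborel_singleton[of t]
        by eventually_elim (auto simp: indicator_def max_def mult_le_0_iff not_le ennreal_neg zero_le_mult_iff)
    qed
    also have "\<dots> = ennreal (pi * t\<^sup>2 - pi * 0\<^sup>2)"
      using False
      by (intro nn_integral_FTC_Icc) (auto intro!: derivative_eq_intros simp: zero_le_mult_iff)
    also have "\<dots> = emeasure lborel (ball (0::complex) t)"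
      using False by (subst emeasure_ball) (auto simp: unit_ball_vol_2)
    finally show ?thesis by (simp add: X M)
  qed
qed

lemma radial_integrable:
  fixes \<phi> :: "real \<Rightarrow> real"
  assumes "continuous_on {0..r} \<phi>"
  shows "set_integrable lborel (ball (0::complex) r) (\<lambda>z. \<phi> (cmod z))"
proof -
  have "continuous_on (cball (0::complex) r) (\<lambda>z. \<phi> (cmod z))"
    by (rule continuous_on_compose2[OF assms]) (auto intro!: continuous_intros)
  then have "set_integrable lborel (cball (0::complex) r) (\<lambda>z. \<phi> (cmod z))"
    unfolding set_integrable_def by (intro borel_integrable_compact) auto
  then show ?thesis
    by (rule set_integrable_subset) auto
qed

lemma radial_integral:
  fixes \<phi> :: "real \<Rightarrow> real"
  assumes \<phi>: "continuous_on {0..r} \<phi>"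
  shows "(LINT z:ball (0::complex) r|lborel. \<phi> (cmod z)) = 2 * pi * integral {0..r} (\<lambda>x. x * \<phi> x)"
proof -
  \<comment> \<open>Cutting off to \<open>{0..<r}\<close> encodes the open disc in the radial
    variable, so that the integral over the disc becomes one against the image measure of
    \<open>cmod\<close>. It also makes the integrand measurable on the whole line.\<close>
  define \<psi> where "\<psi> x = indicator {0..<r} x *\<^sub>R \<phi> x" for x
  have [measurable]: "\<psi> \<in> borel_measurable borel"
    unfolding \<psi>_def[abs_def]
    by (rule borel_measurable_continuous_on_indicator) (auto intro: continuous_on_subset[OF \<phi>])
  have "(LINT z:ball (0::complex) r|lborel. \<phi> (cmod z)) = (\<integral>z. \<psi> (cmod z) \<partial>(lborel :: complex measure))"
    unfolding set_lebesgue_integral_def \<psi>_def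
    by (intro Bochner_Integration.integral_cong) (auto simp: indicator_def)
  also have "\<dots> = (\<integral>x. \<psi> x \<partial>distr (lborel :: complex measure) borel cmod)"
    by (subst integral_distr) auto
  also have "\<dots> = (\<integral>x. max 0 (2 * pi * x) *\<^sub>R \<psi> x \<partial>lborel)"
    unfolding distr_lborel_cmod by (subst integral_density) auto
  also have "\<dots> = (LINT x:{0..<r}|lborel. 2 * pi * (x * \<phi> x))"
    unfolding set_lebesgue_integral_def \<psi>_def
    by (intro Bochner_Integration.integral_cong) (auto simp: indicator_def max_def mult_le_0_iff)
  also have "\<dots> = integral {0..<r} (\<lambda>x. 2 * pi * (x * \<phi> x))"
  proof (rule set_borel_integral_eq_integral(2))
    have "set_integrable lborel {0..r} (\<lambda>x. 2 * pi * (x * \<phi> x))"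
      unfolding set_integrable_def using \<phi>
      by (intro borel_integrable_compact) (auto intro!: continuous_intros)
    then show "set_integrable lborel {0..<r} (\<lambda>x. 2 * pi * (x * \<phi> x))"
      by (rule set_integrable_subset) auto
  qed
  also have "\<dots> = integral {0..r} (\<lambda>x. 2 * pi * (x * \<phi> x))"
    by (rule integral_spike_set; rule negligible_subset[of "{r}"]) auto
  finally show ?thesis by simp
qed

section \<open>Injectivity of the shear\<close>

locale sheared_kfun =
  fixes a lam :: real and h g f :: "complex \<Rightarrow> complex"
  assumes lam: "0 \<le> lam" "lam < 1"
    and hol: "h holomorphic_on ball 0 1" "g holomorphic_on ball 0 1"
    and hg: "\<And>z. z \<in> ball 0 1 \<Longrightarrow> h z - g z = kfun a z"
    and dil: "\<And>z. z \<in> ball 0 1 \<Longrightarrow> deriv g z = (of_real lam * z) * deriv h z"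
    and f: "\<And>z. f z = h z + cnj (g z)"
begin

lemma h_deriv: "cmod z < 1 \<Longrightarrow> (h has_field_derivative deriv h z) (at z)"
  and g_deriv: "cmod z < 1 \<Longrightarrow> (g has_field_derivative deriv g z) (at z)"
  using holomorphic_derivI[OF hol(1) open_ball] holomorphic_derivI[OF hol(2) open_ball] by simp_all

lemma deriv_diff_eq:
  assumes "cmod z < 1"
  shows "deriv h z - deriv g z = kfun' a z"
proof (rule DERIV_unique)
  show "((\<lambda>z. h z - g z) has_field_derivative deriv h z - deriv g z) (at z)"
    by (rule DERIV_diff[OF h_deriv[OF assms] g_deriv[OF assms]])
  show "((\<lambda>z. h z - g z) has_field_derivative kfun' a z) (at z)"
    by (rule has_field_derivative_transform_within_open[OF has_field_derivative_kfun[OF assms], of "ball 0 1"])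
       (use assms hg in auto)
qed

lemma norm_lam_z:
  assumes "cmod z < 1"
  shows "cmod (of_real lam * z) < 1"
proof -
  have "cmod (of_real lam * z) = lam * cmod z" using lam by (simp add: norm_mult)
  also have "\<dots> \<le> 1 * cmod z" using lam by (intro mult_right_mono) auto
  finally show ?thesis using assms by simp
qed

lemma deriv_h_eq:
  assumes "cmod z < 1"
  shows "deriv h z = kfun' a z / (1 - of_real lam * z)"
proof -
  have "deriv h z * (1 - of_real lam * z) = kfun' a z"
    using deriv_diff_eq[OF assms] dil[of z] assms by (simp add: algebra_simps)
  moreover have "1 - of_real lam * z \<noteq> 0"
    by (rule Re_one_pm_pos(4)[OF norm_lam_z[OF assms]])
  ultimately show ?thesis by (simp add: eq_divide_eq)
qed

text \<open>The quotient of (h + g)' by (h - g)' has positive real part, which is what makes the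
  shear injective on horizontal segments.\<close>

lemma deriv_sum_eq:
  assumes "cmod z < 1"
  shows "deriv h z + deriv g z = kfun' a z * ((1 + of_real lam * z) / (1 - of_real lam * z))"
proof -
  have "deriv h z + deriv g z = (1 + of_real lam * z) * deriv h z"
    using dil[of z] assms by (simp add: algebra_simps)
  then show ?thesis by (simp add: deriv_h_eq[OF assms])
qed

lemma Im_f:
  assumes "cmod z < 1"
  shows "Im (f z) = Im (kfun a z)"
  using arg_cong[OF hg[of z], of Im] assms by (simp add: f)

text \<open>The curve \<open>strip_exp \<circ> u\<close> is a lift under \<^term>\<open>kfun a\<close> of a horizontal segment
  traversed with velocity \<open>c\<close>; along it \<open>Re f\<close> is strictly monotone.\<close>

lemma Re_f_ne_along_lift:
  fixes u :: "real \<Rightarrow> complex" and c :: real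
  assumes c: "c \<noteq> 0"
    and strip: "\<And>t. t \<in> {0..1} \<Longrightarrow> \<bar>Im (u t)\<bar> < pi / 2"
    and u: "\<And>t. t \<in> {0..1} \<Longrightarrow>
      (u has_vector_derivative (2 * of_real c * exp (- (of_real a * u t)))) (at t)"
  shows "Re (f (strip_exp (u 0))) \<noteq> Re (f (strip_exp (u 1)))"
proof -
  define Z where "Z t = strip_exp (u t)" for t
  define P where "P t = Re (h (Z t) + g (Z t))" for t
  define P' where "P' t = c * Re ((1 + of_real lam * Z t) / (1 - of_real lam * Z t))" for t
  have P: "(P has_real_derivative P' t) (at t)" if t: "t \<in> {0..1}" for t
  proof -
    let ?e = "exp (u t)"
    have nz: "?e + 1 \<noteq> 0" and Z1: "cmod (Z t) < 1" and LZ: "strip_log (Z t) = u t"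
      using strip_exp[OF strip[OF t]] by (simp_all add: Z_def)
    have Z': "(Z has_vector_derivative
        (2 * of_real c * exp (- (of_real a * u t))) * (2 * ?e / (?e + 1)\<^sup>2)) (at t)"
      using field_vector_diff_chain_at[OF u[OF t] has_field_derivative_strip_exp[OF strip[OF t]]]
      by (simp add: o_def Z_def[abs_def])
    have pm: "1 + Z t = 2 * ?e / (?e + 1)" "1 - Z t = 2 / (?e + 1)"
      using nz by (simp_all add: Z_def strip_exp_def field_simps)
    have k: "kfun' a (Z t) = exp (of_real a * u t) * (?e + 1)\<^sup>2 / (4 * ?e)"
      unfolding kfun'_def LZ pm using nz by (simp add: field_simps power2_eq_square)
    have "((\<lambda>z. h z + g z) has_field_derivative deriv h (Z t) + deriv g (Z t)) (at (Z t))"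
      by (intro DERIV_add h_deriv g_deriv Z1)
    then have "((\<lambda>t. h (Z t) + g (Z t)) has_vector_derivative
        (2 * of_real c * exp (- (of_real a * u t))) * (2 * ?e / (?e + 1)\<^sup>2) * (deriv h (Z t) + deriv g (Z t))) (at t)"
      using field_vector_diff_chain_at[OF Z'] by (simp add: o_def)
    \<comment> \<open>The velocity of \<open>u\<close> is chosen so that it, the derivative of
      \<open>strip_exp\<close> and \<open>kfun'\<close> multiply to \<open>c\<close>; only the
      quotient from \<open>deriv_sum_eq\<close> remains.\<close>
    also have "(2 * of_real c * exp (- (of_real a * u t))) * (2 * ?e / (?e + 1)\<^sup>2) * (deriv h (Z t) + deriv g (Z t))
       = of_real c * ((1 + of_real lam * Z t) / (1 - of_real lam * Z t))"
      unfolding deriv_sum_eq[OF Z1] k exp_minus using nz by simp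
    finally have "(P has_vector_derivative Re (of_real c * ((1 + of_real lam * Z t) / (1 - of_real lam * Z t)))) (at t)"
      unfolding P_def by (rule bounded_linear.has_vector_derivative[OF bounded_linear_Re])
    then show ?thesis
      by (simp only: has_real_derivative_iff_has_vector_derivative P'_def Re_complex_of_real times_complex.sel Im_complex_of_real) simp
  qed
  \<comment> \<open>\<open>P\<close> is \<open>Re f\<close> along the curve, since \<open>g\<close>
    and its conjugate have equal real parts. Its derivative is \<open>c\<close> times a positive
    number, so the mean value theorem separates the endpoints.\<close>
  obtain t where t: "0 < t" "t < 1" "P 1 - P 0 = (1 - 0) * P' t"
    using MVT2[of 0 1 P P'] P by auto
  have "cmod (Z t) < 1" using strip_exp(2)[OF strip[of t]] t by (simp add: Z_def)
  then have "P' t \<noteq> 0"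
    using c Re_cayley_pos[OF norm_lam_z[of "Z t"]] by (simp add: P'_def)
  with t have "P 1 \<noteq> P 0" by auto
  then show ?thesis by (simp add: P_def Z_def f)
qed

text \<open>Since \<open>f\<close> and \<open>kfun a\<close> have the same imaginary part, equal
  values of \<open>f\<close> place the two values of \<open>kfun a\<close> on one horizontal line.
  The segment between them lifts to a curve in the strip joining the two logarithms, and
  \<open>Re f\<close> takes different values at its ends.\<close>

lemma f_injective:
  assumes z: "cmod z1 < 1" "cmod z2 < 1"
    and arg: "\<bar>a * Im (strip_log z1)\<bar> < pi" "\<bar>a * Im (strip_log z2)\<bar> < pi"
    and eq: "f z1 = f z2"
  shows "z1 = z2"
proof (rule ccontr)
  assume ne: "z1 \<noteq> z2"
  let ?L1 = "strip_log z1" and ?L2 = "strip_log z2"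
  define c where "c = Re (kfun a z2 - kfun a z1)"
  have k: "kfun a z2 = kfun a z1 + of_real c"
    using Im_f[OF z(1)] Im_f[OF z(2)] eq by (simp add: complex_eq_iff c_def)
  have Lne: "?L1 \<noteq> ?L2"
    using ne z strip_exp_log by metis
  have "\<exists>u. u 0 = ?L1 \<and> u 1 = ?L2 \<and> c \<noteq> 0 \<and> (\<forall>t\<in>{0..1}. \<bar>Im (u t)\<bar> < pi / 2 \<and>
      (u has_vector_derivative (2 * of_real c * exp (- (of_real a * u t)))) (at t))"
  proof (cases "a = 0")
    case True
    \<comment> \<open>For \<open>a = 0\<close> the function is half of \<open>strip_log\<close>, so
      the lift is itself a horizontal segment.\<close>
    have L2: "?L2 = ?L1 + of_real (2 * c)"
      using k z True by (simp add: kfun_strip_log field_simps)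
    define u where "u t = ?L1 + of_real t * of_real (2 * c)" for t
    have "(u has_vector_derivative (2 * of_real c * exp (- (of_real a * u t)))) (at t)" for t
      unfolding u_def by (auto intro!: derivative_eq_intros simp: True)
    moreover have "\<bar>Im (u t)\<bar> < pi / 2" for t
      using Im_strip_log[OF z(1)] by (simp add: u_def)
    ultimately show ?thesis
      using L2 Lne by (intro exI[of _ u]) (auto simp: u_def)
  next
    case False
    \<comment> \<open>\<open>W\<close> is the segment between the values of 1 + 2 a k_a, which are
      the exponentials of \<open>a\<close> times the strip coordinate. This explains the increment
      \<open>2 * a * c\<close>; the lift is \<open>Ln (W t) / of_real a\<close>.\<close>
    define W where "W t = exp (of_real a * ?L1) + of_real t * of_real (2 * a * c)" for t
    have W1: "W 1 = exp (of_real a * ?L2)"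
      using k z False by (simp add: kfun_strip_log W_def field_simps)
    have W0: "W 0 = exp (of_real a * ?L1)" by (simp add: W_def)
    \<comment> \<open>The bound \<open>pi\<close> in the hypotheses enters here: it lets the
      principal logarithm recover both endpoints, so the lift starts and ends where it
      should.\<close>
    have Ln: "Ln (W 0) = of_real a * ?L1" "Ln (W 1) = of_real a * ?L2"
      unfolding W0 W1 using arg by (auto intro!: Ln_exp)
    have "c \<noteq> 0"
    proof
      assume "c = 0"
      then have "W 0 = W 1" by (simp add: W_def)
      with Ln have "of_real a * ?L1 = of_real a * ?L2" by metis
      with False Lne show False by simp
    qed
    have slit: "W 0 \<notin> \<real>\<^sub>\<le>\<^sub>0" "W 1 \<notin> \<real>\<^sub>\<le>\<^sub>0"
    proof -
      have "w \<notin> \<real>\<^sub>\<le>\<^sub>0" if "w \<noteq> 0" "\<bar>Im (Ln w)\<bar> < pi" for w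
        using that Im_Ln_eq_pi[of w] by (auto simp: complex_nonpos_Reals_iff complex_eq_iff)
      from this[of "W 0"] this[of "W 1"] show "W 0 \<notin> \<real>\<^sub>\<le>\<^sub>0" "W 1 \<notin> \<real>\<^sub>\<le>\<^sub>0"
        using arg Ln W0 W1 by auto
    qed
    have ImL: "\<bar>a * Im ?L1\<bar> < \<bar>a\<bar> * (pi / 2)" "\<bar>a * Im ?L2\<bar> < \<bar>a\<bar> * (pi / 2)"
      unfolding abs_mult using False Im_strip_log z by (auto intro!: mult_strict_left_mono)
    \<comment> \<open>Avoiding the slit makes \<open>Ln\<close> differentiable along
      \<open>W\<close>, and the bound \<open>\<bar>a\<bar> * (pi / 2)\<close> keeps the lift, after
      division by \<open>a\<close>, inside the strip.\<close>
    have Wt: "W t \<notin> \<real>\<^sub>\<le>\<^sub>0 \<and> \<bar>Im (Ln (W t))\<bar> < min pi (\<bar>a\<bar> * (pi / 2))" if t: "t \<in> {0..1}" for t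
    proof (rule sector_horizontally_convex[OF slit])
      show "Re (W t) \<in> closed_segment (Re (W 0)) (Re (W 1))"
        unfolding closed_segment_def using t by (auto simp: W_def algebra_simps intro!: exI[of _ t])
      show "\<bar>Im (Ln (W 0))\<bar> < min pi (\<bar>a\<bar> * (pi / 2))" "\<bar>Im (Ln (W 1))\<bar> < min pi (\<bar>a\<bar> * (pi / 2))"
        unfolding Ln using arg ImL by auto
    qed (simp_all add: W_def)
    define u where "u t = Ln (W t) / of_real a" for t
    have "(u has_vector_derivative (2 * of_real c * exp (- (of_real a * u t)))) (at t)" if t: "t \<in> {0..1}" for t
    proof -
      have nz: "W t \<noteq> 0" using Wt[OF t] by auto
      have "(W has_vector_derivative of_real (2 * a * c)) (at t)"
        unfolding W_def by (auto intro!: derivative_eq_intros)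
      moreover have "((\<lambda>w. Ln w / of_real a) has_field_derivative inverse (W t) / of_real a) (at (W t))"
        by (intro DERIV_cdivide has_field_derivative_Ln) (use Wt[OF t] in auto)
      ultimately have "(u has_vector_derivative (of_real (2 * a * c) * (inverse (W t) / of_real a))) (at t)"
        using field_vector_diff_chain_at by (fastforce simp: o_def u_def[abs_def])
      moreover have "exp (of_real a * u t) = W t"
        using False nz by (simp add: u_def)
      ultimately show ?thesis
        using False nz by (simp add: exp_minus field_simps)
    qed
    moreover have "\<bar>Im (u t)\<bar> < pi / 2" if t: "t \<in> {0..1}" for t
      using Wt[OF t] False by (simp add: u_def Im_divide_of_real abs_divide pos_divide_less_eq mult.commute)
    moreover have "u 0 = ?L1" "u 1 = ?L2"
      using False by (simp_all add: u_def Ln)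
    ultimately show ?thesis using \<open>c \<noteq> 0\<close> by blast
  qed
  then obtain u where u: "u 0 = ?L1" "u 1 = ?L2" "c \<noteq> 0" "\<And>t. t \<in> {0..1} \<Longrightarrow> \<bar>Im (u t)\<bar> < pi / 2"
      "\<And>t. t \<in> {0..1} \<Longrightarrow> (u has_vector_derivative (2 * of_real c * exp (- (of_real a * u t)))) (at t)"
    by blast
  have "Re (f (strip_exp (u 0))) \<noteq> Re (f (strip_exp (u 1)))"
    by (rule Re_f_ne_along_lift[OF u(3-5)])
  with eq show False by (simp add: u strip_exp_log z)
qed

section \<open>Discs on which \<open>f\<close> is injective\<close>

lemma inj_on_disc:
  assumes "\<bar>a\<bar> \<le> 2" "s \<le> 1"
  shows "inj_on f (ball 0 s)"
proof (rule inj_onI)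
  fix z1 z2 assume z: "z1 \<in> ball 0 s" "z2 \<in> ball 0 s" "f z1 = f z2"
  have "\<bar>a * Im (strip_log z)\<bar> < pi" if "z \<in> ball 0 s" for z
  proof -
    have "\<bar>a * Im (strip_log z)\<bar> \<le> 2 * \<bar>Im (strip_log z)\<bar>"
      using assms by (simp add: abs_mult mult_right_mono)
    also have "\<dots> < pi" using Im_strip_log[of z] that assms by simp
    finally show ?thesis .
  qed
  with z assms show "z1 = z2" by - (rule f_injective, auto)
qed

text \<open>For |z| < 1/2 each of the two logarithms is at most 2|z| in modulus, so |Im (strip_log
  z)| is at most 4|z|. With |z| < 1/(2|a|), multiplication by |a| gives less than 2, hence less than
  pi.\<close>

lemma inj_on_small_disc:
  assumes "\<bar>a\<bar> \<ge> 2"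
  shows "inj_on f (ball 0 (1 / (2 * \<bar>a\<bar>)))"
proof (rule inj_onI)
  fix z1 z2 assume z: "z1 \<in> ball 0 (1 / (2 * \<bar>a\<bar>))" "z2 \<in> ball 0 (1 / (2 * \<bar>a\<bar>))" "f z1 = f z2"
  have le: "1 / (2 * \<bar>a\<bar>) \<le> 1 / 4" using assms by (simp add: field_simps)
  have "\<bar>a * Im (strip_log z)\<bar> < pi" if "z \<in> ball 0 (1 / (2 * \<bar>a\<bar>))" for z
  proof -
    have z: "cmod z < 1 / 2" using that le by auto
    have "\<bar>Im (strip_log z)\<bar> \<le> cmod (Ln (1 + z) - Ln (1 + - z))"
      unfolding strip_log_def using abs_Im_le_cmod[of "Ln (1 + z) - Ln (1 - z)"] by simp
    also have "\<dots> \<le> cmod (Ln (1 + z)) + cmod (Ln (1 + - z))" by (rule norm_triangle_ineq4)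
    also have "\<dots> \<le> 4 * cmod z" using norm_Ln_le[of z] norm_Ln_le[of "- z"] z by simp
    finally have "\<bar>a * Im (strip_log z)\<bar> \<le> 2 * (cmod z * (2 * \<bar>a\<bar>))"
      using mult_left_mono[of "\<bar>Im (strip_log z)\<bar>" "4 * cmod z" "\<bar>a\<bar>"]
      by (simp add: abs_mult algebra_simps)
    moreover have "cmod z * (2 * \<bar>a\<bar>) < 1" using that assms by (simp add: pos_less_divide_eq)
    ultimately show ?thesis using pi_gt3 by linarith
  qed
  with z le show "z1 = z2" by - (rule f_injective, auto)
qed

section \<open>The Jacobian of \<open>f\<close>, in terms of moduli only\<close>

definition jac :: "complex \<Rightarrow> real" where
  "jac z = (1 - lam\<^sup>2 * (cmod z)\<^sup>2) * cmod (1 + z) powr (2 * (a - 1))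
     / ((cmod (1 - of_real lam * z))\<^sup>2 * cmod (1 - z) powr (2 * (a + 1)))"

lemma jac_eq:
  assumes "cmod z < 1"
  shows "jac z = (cmod (deriv h z))\<^sup>2 - (cmod (deriv g z))\<^sup>2"
proof -
  have "deriv g z = of_real lam * z * deriv h z" using dil[of z] assms by simp
  then have *: "(cmod (deriv h z))\<^sup>2 - (cmod (deriv g z))\<^sup>2 = (1 - lam\<^sup>2 * (cmod z)\<^sup>2) * (cmod (deriv h z))\<^sup>2"
    by (simp add: norm_mult power_mult_distrib algebra_simps)
  have "(cmod (deriv h z))\<^sup>2 = cmod (1 + z) powr (2 * (a - 1)) / cmod (1 - z) powr (2 * (a + 1))
      / (cmod (1 - of_real lam * z))\<^sup>2"
    unfolding deriv_h_eq[OF assms] norm_divide power_divide norm_kfun'[OF assms] ..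
  then show ?thesis unfolding jac_def * by (simp only: divide_divide_eq_left times_divide_eq_right mult.commute)
qed

lemma lam_rho:
  assumes "0 \<le> x" "x < 1"
  shows "0 < 1 - lam\<^sup>2 * x\<^sup>2"
proof -
  have "lam * x \<le> 1 * x" using lam assms by (intro mult_right_mono) auto
  then have "(lam * x)\<^sup>2 < 1" using lam assms by (simp add: power_less_one_iff)
  then show ?thesis by (simp add: power_mult_distrib)
qed

lemma jac_nonneg:
  assumes "cmod z < 1"
  shows "jac z \<ge> 0"
  unfolding jac_def using lam_rho[OF norm_ge_zero assms] by simp

lemma continuous_on_jac: "s < 1 \<Longrightarrow> continuous_on (cball 0 s) jac"
proof (unfold jac_def[abs_def], intro continuous_intros ballI)
  fix z :: complex assume "s < 1" "z \<in> cball 0 s"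
  then have z: "cmod z < 1" by simp
  then show "(cmod (1 - of_real lam * z))\<^sup>2 * cmod (1 - z) powr (2 * (a + 1)) \<noteq> 0"
    "cmod (1 + z) \<noteq> 0" "cmod (1 - z) \<noteq> 0"
    using Re_one_pm_pos[OF z] Re_one_pm_pos(4)[OF norm_lam_z[OF z]] by simp_all
qed

lemma f_has_derivative:
  assumes "cmod z < 1"
  shows "(f has_derivative (\<lambda>v. deriv h z * v + cnj (deriv g z * v))) (at z)"
  unfolding f[abs_def]
  by (rule has_derivative_add[OF has_field_derivative_imp_has_derivative[OF h_deriv[OF assms]]
        bounded_linear.has_derivative[OF bounded_linear_cnj
          has_field_derivative_imp_has_derivative[OF g_deriv[OF assms]]]])

lemma planar_jacobian_disc:
  assumes "s < 1"
  shows "planar_jacobian f (deriv h) (deriv g) (ball 0 s) jac"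
proof
  show "ball 0 s \<in> sets (borel :: complex measure)" by simp
  \<comment> \<open>Exhausting the disc by compact sets shows that its image is a countable union of
    compact sets, hence Borel.\<close>
  obtain C :: "nat \<Rightarrow> complex set" where C: "\<And>n. compact (C n)" "\<And>n. C n \<subseteq> ball 0 s" "\<Union>(range C) = ball 0 s"
    by (rule open_Union_compact_subsets[OF open_ball[of "0::complex" s]]) blast
  have cont: "continuous_on (ball 0 s) f"
    by (rule has_derivative_continuous_on[OF has_derivative_at_withinI[OF f_has_derivative]])
       (use assms in simp)
  have "compact (f ` C n)" for n
    by (rule compact_continuous_image[OF continuous_on_subset[OF cont C(2)] C(1)])
  then have "(\<Union>n. f ` C n) \<in> sets borel"
    by (intro sets.countable_UN) (auto intro: borel_compact simp: image_subset_iff)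
  then show "f ` ball 0 s \<in> sets borel" unfolding C(3)[symmetric] image_UN .
  show "(f has_derivative (\<lambda>v. deriv h z * v + cnj (deriv g z * v))) (at z)" if "z \<in> ball 0 s" for z
    using f_has_derivative that assms by simp
  show "jac z = \<bar>(cmod (deriv h z))\<^sup>2 - (cmod (deriv g z))\<^sup>2\<bar>" if "z \<in> ball 0 s" for z
    using that assms jac_nonneg[of z] by (simp add: jac_eq)
  have "set_integrable lborel (cball 0 s) jac"
    unfolding set_integrable_def using continuous_on_jac[OF assms]
    by (intro borel_integrable_compact) auto
  then show "set_integrable lborel (ball 0 s) jac"
    by (rule set_integrable_subset) auto
qed

end

section \<open>Estimates of the Jacobian and the area\<close>

lemma linear_form_bounds:
  fixes a p q l L :: real
  assumes "l \<le> p" "p \<le> L" "l \<le> q" "q \<le> L"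
  defines "b \<equiv> max 1 \<bar>a\<bar>"
  shows "(b - 1) * l - (b + 1) * L \<le> (a - 1) * p - (a + 1) * q"
    and "(a - 1) * p - (a + 1) * q \<le> (b - 1) * L - (b + 1) * l"
proof -
  \<comment> \<open>The extreme values on the square are taken at corners determined by the signs of
    \<open>a - 1\<close> and \<open>a + 1\<close>. In each of the three sign patterns they agree
    with the same expression in \<open>b\<close>.\<close>
  consider "a \<ge> 1" "b = a" | "a \<le> - 1" "b = - a" | "- 1 < a" "a < 1" "b = 1"
    unfolding b_def by linarith
  then have "(b - 1) * l - (b + 1) * L \<le> (a - 1) * p - (a + 1) * q \<and>
    (a - 1) * p - (a + 1) * q \<le> (b - 1) * L - (b + 1) * l"
  proof cases
    case 1
    then have "(a - 1) * l \<le> (a - 1) * p" "(a - 1) * p \<le> (a - 1) * L"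
      "(a + 1) * l \<le> (a + 1) * q" "(a + 1) * q \<le> (a + 1) * L"
      using assms by (auto intro!: mult_left_mono)
    then show ?thesis unfolding \<open>b = a\<close> by linarith
  next
    case 2
    then have "(b + 1) * l \<le> (b + 1) * p" "(b + 1) * p \<le> (b + 1) * L"
      "(b - 1) * l \<le> (b - 1) * q" "(b - 1) * q \<le> (b - 1) * L"
      using assms by (auto intro!: mult_left_mono)
    with 2 show ?thesis by (auto simp: algebra_simps)
  next
    case 3
    then have "(1 - a) * l \<le> (1 - a) * p" "(1 - a) * p \<le> (1 - a) * L"
      "(a + 1) * l \<le> (a + 1) * q" "(a + 1) * q \<le> (a + 1) * L"
      using assms by (auto intro!: mult_left_mono)
    with 3 show ?thesis by (auto simp: algebra_simps)
  qed
  then show "(b - 1) * l - (b + 1) * L \<le> (a - 1) * p - (a + 1) * q"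
    and "(a - 1) * p - (a + 1) * q \<le> (b - 1) * L - (b + 1) * l" by auto
qed

lemma powr_quotient_eq_exp:
  fixes x y :: real
  assumes "x > 0" "y > 0"
  shows "x powr (2 * (a - 1)) / y powr (2 * (b + 1)) = exp (2 * ((a - 1) * ln x - (b + 1) * ln y))"
  unfolding right_diff_distrib exp_diff using assms by (simp add: powr_def algebra_simps)

lemma norm_one_pm_bounds:
  fixes z :: complex
  shows "1 - cmod z \<le> cmod (1 + z)" "cmod (1 + z) \<le> 1 + cmod z"
    "1 - cmod z \<le> cmod (1 - z)" "cmod (1 - z) \<le> 1 + cmod z"
  using norm_triangle_ineq2[of 1 "- z"] norm_triangle_ineq[of 1 z]
    norm_triangle_ineq2[of 1 z] norm_triangle_ineq4[of 1 z] by simp_all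

text \<open>The logarithm of \<open>R\<close> is twice a linear form in ln |1 + z| and ln |1 - z|,
  and both of these lie between ln (1 - |z|) and ln (1 + |z|).\<close>

lemma powr_quotient_bounds:
  fixes a :: real
  assumes "cmod z < 1"
  defines "b \<equiv> max 1 \<bar>a\<bar>" and "R \<equiv> cmod (1 + z) powr (2 * (a - 1)) / cmod (1 - z) powr (2 * (a + 1))"
  shows "(1 - cmod z) powr (2 * (b - 1)) / (1 + cmod z) powr (2 * (b + 1)) \<le> R"
    and "R \<le> (1 + cmod z) powr (2 * (b - 1)) / (1 - cmod z) powr (2 * (b + 1))"
proof -
  have pos: "0 < 1 - cmod z" "0 < 1 + cmod z" "0 < cmod (1 + z)" "0 < cmod (1 - z)"
    using assms(1) norm_one_pm_bounds[of z] by (simp_all add: add_pos_nonneg Re_one_pm_pos)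
  have ln: "ln (1 - cmod z) \<le> ln (cmod (1 + z))" "ln (cmod (1 + z)) \<le> ln (1 + cmod z)"
    "ln (1 - cmod z) \<le> ln (cmod (1 - z))" "ln (cmod (1 - z)) \<le> ln (1 + cmod z)"
    using pos norm_one_pm_bounds[of z] by (simp_all only: ln_le_cancel_iff)
  show "(1 - cmod z) powr (2 * (b - 1)) / (1 + cmod z) powr (2 * (b + 1)) \<le> R"
    and "R \<le> (1 + cmod z) powr (2 * (b - 1)) / (1 - cmod z) powr (2 * (b + 1))"
    using linear_form_bounds[OF ln, of a]
    unfolding R_def powr_quotient_eq_exp[OF pos(1,2)] powr_quotient_eq_exp[OF pos(2,1)]
      powr_quotient_eq_exp[OF pos(3,4)] b_def by simp_all
qed

section \<open>Two explicit radial integrals\<close>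

lemma cauchy_kernel_integral:
  fixes s :: real
  assumes "0 \<le> s"
  shows "integral {0..s} (\<lambda>x. x / (1 + x\<^sup>2)\<^sup>2) = s\<^sup>2 / (1 + s\<^sup>2) / 2"
proof -
  have "((\<lambda>x. x / (1 + x\<^sup>2)\<^sup>2) has_integral (s\<^sup>2 / (1 + s\<^sup>2) / 2 - 0\<^sup>2 / (1 + 0\<^sup>2) / 2)) {0..s}"
  proof (rule fundamental_theorem_of_calculus[OF assms])
    fix x :: real
    have nz: "1 + x\<^sup>2 \<noteq> 0" by (smt (verit) zero_le_power2)
    have "((\<lambda>x. x\<^sup>2 / (1 + x\<^sup>2) / 2) has_real_derivative
        ((2 * x) * (1 + x\<^sup>2) - x\<^sup>2 * (2 * x)) / ((1 + x\<^sup>2) * (1 + x\<^sup>2)) / 2) (at x within {0..s})"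
      by (rule DERIV_cdivide[OF DERIV_divide]) (use nz in \<open>auto intro!: derivative_eq_intros\<close>)
    also have "((2 * x) * (1 + x\<^sup>2) - x\<^sup>2 * (2 * x)) / ((1 + x\<^sup>2) * (1 + x\<^sup>2)) / 2 = x / (1 + x\<^sup>2)\<^sup>2"
    proof -
      have "(2 * x) * (1 + x\<^sup>2) - x\<^sup>2 * (2 * x) = 2 * x" by (simp add: algebra_simps)
      moreover have "2 * x / (D * D) / 2 = x / D\<^sup>2" for D :: real by (simp add: power2_eq_square)
      ultimately show ?thesis by metis
    qed
    finally show "((\<lambda>x. x\<^sup>2 / (1 + x\<^sup>2) / 2) has_vector_derivative x / (1 + x\<^sup>2)\<^sup>2) (at x within {0..s})"
      by (simp add: has_real_derivative_iff_has_vector_derivative)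
  qed
  then show ?thesis by (simp add: integral_unique)
qed

text \<open>The substitution \<open>t = (1 - x) / (1 + x)\<close> turns the integrand into
  \<open>(t powr (2 * b - 2) - t powr (2 * b)) / 8\<close>.\<close>

lemma lower_kernel_integral:
  fixes b r :: real
  assumes b: "b > 1" and r: "0 < r" "r < 1"
  shows "(\<lambda>x. x * ((1 - x) powr (2 * (b - 1)) / (1 + x) powr (2 * (b + 1)))) integrable_on {0..r}"
    and "integral {0..r} (\<lambda>x. x * ((1 - x) powr (2 * (b - 1)) / (1 + x) powr (2 * (b + 1))))
      \<le> 1 / (4 * (4 * b\<^sup>2 - 1))"
proof -
  define t where "t x = (1 - x) / (1 + x)" for x :: real
  define F where "F x = (t x powr (2 * b + 1) / (2 * b + 1) - t x powr (2 * b - 1) / (2 * b - 1)) / 8" for x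
  have "((\<lambda>x. x * ((1 - x) powr (2 * (b - 1)) / (1 + x) powr (2 * (b + 1)))) has_integral (F r - F 0)) {0..r}"
  proof (rule fundamental_theorem_of_calculus)
    fix x assume x: "x \<in> {0..r}"
    have tpos: "t x > 0" and nz: "1 + x > 0" "1 - x > 0" using x r by (auto simp: t_def)
    have t': "(t has_real_derivative - 2 / (1 + x)\<^sup>2) (at x)"
    proof -
      have "(t has_real_derivative ((- 1) * (1 + x) - (1 - x) * 1) / ((1 + x) * (1 + x))) (at x)"
        unfolding t_def[abs_def] using nz by (auto intro!: derivative_eq_intros)
      then show ?thesis by (simp add: power2_eq_square)
    qed
    have pw: "((\<lambda>x. t x powr c) has_real_derivative c * t x powr (c - 1) * (- 2 / (1 + x)\<^sup>2)) (at x)" for c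
      using DERIV_fun_powr[OF t' tpos, of c] by simp
    have "(F has_real_derivative
       (((2 * b + 1) * t x powr (2 * b + 1 - 1) * (- 2 / (1 + x)\<^sup>2)) / (2 * b + 1)
         - ((2 * b - 1) * t x powr (2 * b - 1 - 1) * (- 2 / (1 + x)\<^sup>2)) / (2 * b - 1)) / 8) (at x)"
      unfolding F_def[abs_def] by (intro DERIV_cdivide DERIV_diff pw)
    also have "(((2 * b + 1) * t x powr (2 * b + 1 - 1) * (- 2 / (1 + x)\<^sup>2)) / (2 * b + 1)
         - ((2 * b - 1) * t x powr (2 * b - 1 - 1) * (- 2 / (1 + x)\<^sup>2)) / (2 * b - 1)) / 8
       = (t x powr (2 * b - 2) - t x powr (2 * b)) / (4 * (1 + x)\<^sup>2)"
      using b by (simp add: diff_divide_distrib)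
    also have "t x powr (2 * b) = t x powr (2 * b - 2) * (t x)\<^sup>2"
      using tpos powr_add[of "t x" "2 * b - 2" 2] by (simp add: powr_numeral)
    also have "(t x powr (2 * b - 2) - t x powr (2 * b - 2) * (t x)\<^sup>2) / (4 * (1 + x)\<^sup>2)
       = t x powr (2 * b - 2) * ((1 - (t x)\<^sup>2) / (4 * (1 + x)\<^sup>2))"
      by (simp add: algebra_simps)
    also have "(1 - (t x)\<^sup>2) / (4 * (1 + x)\<^sup>2) = x / (1 + x) ^ 4"
    proof -
      have "1 - (t x)\<^sup>2 = 4 * x / (1 + x)\<^sup>2"
        using nz unfolding t_def by (simp add: power_divide field_simps) (simp add: power2_eq_square algebra_simps)
      then show ?thesis by (simp add: power2_eq_square power4_eq_xxxx mult.assoc)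
    qed
    also have "t x powr (2 * b - 2) * (x / (1 + x) ^ 4) = x * ((1 - x) powr (2 * (b - 1)) / (1 + x) powr (2 * (b + 1)))"
    proof -
      have "(1 + x) powr (2 * (b + 1)) = (1 + x) powr (2 * b - 2) * (1 + x) ^ 4"
        using nz powr_add[of "1 + x" "2 * b - 2" 4] by (simp add: powr_numeral add.commute)
      moreover have "t x powr (2 * b - 2) = (1 - x) powr (2 * (b - 1)) / (1 + x) powr (2 * b - 2)"
        using nz unfolding t_def by (simp add: powr_divide algebra_simps)
      ultimately show ?thesis by simp
    qed
    finally show "(F has_vector_derivative x * ((1 - x) powr (2 * (b - 1)) / (1 + x) powr (2 * (b + 1)))) (at x within {0..r})"
      by (simp add: has_real_derivative_iff_has_vector_derivative has_vector_derivative_at_within)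
  qed (use r in simp)
  \<comment> \<open>\<open>F\<close> vanishes at 1, so dropping \<open>F r\<close> amounts to
    extending the integral to all of [0, 1]. The bound \<open>- F 0\<close> is therefore uniform in
    \<open>r\<close>.\<close>
  moreover have "F r \<le> 0"
  proof -
    have "0 \<le> t r" "t r \<le> 1" using r by (simp_all add: t_def)
    then have "t r powr (2 * b + 1) \<le> t r powr (2 * b - 1)" using powr_mono' by fastforce
    then have "t r powr (2 * b + 1) / (2 * b + 1) \<le> t r powr (2 * b - 1) / (2 * b - 1)"
      using b by (intro frac_le) auto
    then show ?thesis by (simp add: F_def)
  qed
  moreover have "- F 0 = 1 / (4 * (4 * b\<^sup>2 - 1))"
  proof -
    have "(2 * b + 1) * (2 * b - 1) = 4 * b\<^sup>2 - 1" by (simp add: power2_eq_square algebra_simps)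
    moreover have "- F 0 = 2 / ((2 * b + 1) * (2 * b - 1)) / 8"
      using b by (simp add: F_def t_def field_simps)
    moreover have "2 / D / 8 = 1 / (4 * D)" for D :: real by simp
    ultimately show ?thesis by metis
  qed
  ultimately show "(\<lambda>x. x * ((1 - x) powr (2 * (b - 1)) / (1 + x) powr (2 * (b + 1)))) integrable_on {0..r}"
    "integral {0..r} (\<lambda>x. x * ((1 - x) powr (2 * (b - 1)) / (1 + x) powr (2 * (b + 1)))) \<le> 1 / (4 * (4 * b\<^sup>2 - 1))"
    by (auto simp: integral_unique integrable_on_def)
qed

text \<open>Lebesgue measure and the centred disc are invariant under negation. This allows
  \<open>jac\<close> to be averaged over \<open>z\<close> and \<open>- z\<close>.\<close>

lemma lborel_reflect_disc:
  fixes \<phi> :: "complex \<Rightarrow> real"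
  assumes "set_integrable lborel (ball 0 s) \<phi>"
  shows "set_integrable lborel (ball 0 s) (\<lambda>z. \<phi> (- z))"
    and "(LINT z:ball 0 s|lborel. \<phi> (- z)) = (LINT z:ball 0 s|lborel. \<phi> z)"
proof -
  have D: "distr lborel borel uminus = (lborel :: complex measure)"
    using lborel_affine[of "- 1" "0 :: complex"] by (simp add: density_1 flip: one_ennreal_def)
  let ?g = "\<lambda>z. indicator (ball 0 s) z *\<^sub>R \<phi> z"
  have i: "integrable (distr lborel borel uminus) ?g"
    using assms by (simp add: D set_integrable_def)
  have m: "?g \<in> borel_measurable borel"
    using borel_measurable_integrable[OF assms[unfolded set_integrable_def]] by simp
  have ind: "indicator (ball 0 s) (- z) = (indicator (ball 0 s) z :: real)" for z :: complex
    by (simp add: indicator_def)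
  show "set_integrable lborel (ball 0 s) (\<lambda>z. \<phi> (- z))"
    using integrable_distr[OF _ i] by (simp add: set_integrable_def ind)
  have "(LINT z:ball 0 s|lborel. \<phi> z) = (\<integral>z. ?g z \<partial>distr lborel borel uminus)"
    by (simp add: D set_lebesgue_integral_def)
  also have "\<dots> = (\<integral>z. ?g (- z) \<partial>lborel)"
    by (rule integral_distr[OF _ m]) simp
  finally show "(LINT z:ball 0 s|lborel. \<phi> (- z)) = (LINT z:ball 0 s|lborel. \<phi> z)"
    by (simp add: set_lebesgue_integral_def ind)
qed

context sheared_kfun
begin

section \<open>Radial bounds for the Jacobian and the resulting areas\<close>

definition lower_jac :: "real \<Rightarrow> real \<Rightarrow> real" where
  "lower_jac b x = (1 - lam\<^sup>2 * x\<^sup>2) * (1 - x) powr (2 * (b - 1)) / ((1 + lam * x)\<^sup>2 * (1 + x) powr (2 * (b + 1)))"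

definition upper_jac :: "real \<Rightarrow> real \<Rightarrow> real" where
  "upper_jac b x = (1 - lam\<^sup>2 * x\<^sup>2) * (1 + x) powr (2 * (b - 1)) / ((1 - lam * x)\<^sup>2 * (1 - x) powr (2 * (b + 1)))"

lemma lam_mult_bounds:
  assumes "0 \<le> x" "x < 1"
  shows "0 \<le> lam * x" "lam * x < 1"
  using lam assms mult_right_mono[of lam 1 x] by auto

lemma continuous_on_lower_jac: "r < 1 \<Longrightarrow> continuous_on {0..r} (lower_jac b)"
  and continuous_on_upper_jac: "r < 1 \<Longrightarrow> continuous_on {0..r} (upper_jac b)"
proof -
  assume r: "r < 1"
  have nz: "1 + lam * x \<noteq> 0" "1 - lam * x \<noteq> 0" "1 + x \<noteq> 0" "1 - x \<noteq> 0" if "x \<in> {0..r}" for x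
    using lam_mult_bounds[of x] that r by auto
  show "continuous_on {0..r} (lower_jac b)"
    unfolding lower_jac_def[abs_def] by (intro continuous_intros ballI) (use nz in auto)
  show "continuous_on {0..r} (upper_jac b)"
    unfolding upper_jac_def[abs_def] by (intro continuous_intros ballI) (use nz in auto)
qed

lemma jac_bounds:
  assumes z: "cmod z < 1"
  shows "lower_jac (max 1 \<bar>a\<bar>) (cmod z) \<le> jac z" and "jac z \<le> upper_jac (max 1 \<bar>a\<bar>) (cmod z)"
proof -
  let ?\<rho> = "cmod z" and ?b = "max 1 \<bar>a\<bar>"
  define d where "d = cmod (1 - of_real lam * z)"
  define R where "R = cmod (1 + z) powr (2 * (a - 1)) / cmod (1 - z) powr (2 * (a + 1))"
  have jac: "jac z = (1 - lam\<^sup>2 * ?\<rho>\<^sup>2) / d\<^sup>2 * R"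
    by (simp add: jac_def d_def R_def)
  have "cmod (of_real lam * z) = lam * ?\<rho>" using lam by (simp add: norm_mult)
  then have d: "1 - lam * ?\<rho> \<le> d" "d \<le> 1 + lam * ?\<rho>"
    using norm_one_pm_bounds(3,4)[of "of_real lam * z"] by (simp_all add: d_def)
  have pos: "0 < 1 - lam * ?\<rho>" "0 < 1 - lam\<^sup>2 * ?\<rho>\<^sup>2"
    using lam_mult_bounds[of ?\<rho>] lam_rho[of ?\<rho>] z by auto
  have "lower_jac ?b ?\<rho> = (1 - lam\<^sup>2 * ?\<rho>\<^sup>2) / (1 + lam * ?\<rho>)\<^sup>2
      * ((1 - ?\<rho>) powr (2 * (?b - 1)) / (1 + ?\<rho>) powr (2 * (?b + 1)))"
    by (simp add: lower_jac_def)
  also have "\<dots> \<le> (1 - lam\<^sup>2 * ?\<rho>\<^sup>2) / d\<^sup>2 * R"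
    using d pos powr_quotient_bounds(1)[OF z, of a, folded R_def]
    by (intro mult_mono divide_left_mono power_mono) (auto intro!: mult_pos_pos)
  finally show "lower_jac ?b ?\<rho> \<le> jac z" by (simp add: jac)
  have "jac z \<le> (1 - lam\<^sup>2 * ?\<rho>\<^sup>2) / (1 - lam * ?\<rho>)\<^sup>2
      * ((1 + ?\<rho>) powr (2 * (?b - 1)) / (1 - ?\<rho>) powr (2 * (?b + 1)))"
    unfolding jac using d pos powr_quotient_bounds(2)[OF z, of a, folded R_def]
    by (intro mult_mono divide_left_mono power_mono) (auto simp: R_def intro!: mult_pos_pos)
  also have "\<dots> = upper_jac ?b ?\<rho>"
    by (simp add: upper_jac_def)
  finally show "jac z \<le> upper_jac ?b ?\<rho>" .
qed

lemma area_upper: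
  assumes "r < 1"
  shows "area (f ` ball 0 r) \<le> 2 * pi * integral {0..r} (\<lambda>x. x * upper_jac (max 1 \<bar>a\<bar>) x)"
proof -
  interpret P: planar_jacobian f "deriv h" "deriv g" "ball 0 r" jac
    by (rule planar_jacobian_disc[OF assms])
  note cont = continuous_on_upper_jac[OF assms, of "max 1 \<bar>a\<bar>"]
  have "area (f ` ball 0 r) \<le> (LINT z:ball 0 r|lborel. jac z)" by (rule P.area_image_le)
  also have "\<dots> \<le> (LINT z:ball (0::complex) r|lborel. upper_jac (max 1 \<bar>a\<bar>) (cmod z))"
    by (rule set_integral_mono[OF P.int radial_integrable[OF cont]]) (use jac_bounds assms in auto)
  finally show ?thesis by (simp add: radial_integral[OF cont])
qed

lemma area_lower_injective:
  assumes "r < 1" "inj_on f (ball 0 r)"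
  shows "2 * pi * integral {0..r} (\<lambda>x. x * lower_jac (max 1 \<bar>a\<bar>) x) \<le> area (f ` ball 0 r)"
proof -
  interpret P: planar_jacobian f "deriv h" "deriv g" "ball 0 r" jac
    by (rule planar_jacobian_disc[OF assms(1)])
  note cont = continuous_on_lower_jac[OF assms(1), of "max 1 \<bar>a\<bar>"]
  have "(LINT z:ball (0::complex) r|lborel. lower_jac (max 1 \<bar>a\<bar>) (cmod z)) \<le> (LINT z:ball 0 r|lborel. jac z)"
    by (rule set_integral_mono[OF radial_integrable[OF cont] P.int]) (use jac_bounds assms in auto)
  also have "\<dots> = area (f ` ball 0 r)" by (rule P.area_image_eq[OF assms(2), symmetric])
  finally show ?thesis by (simp add: radial_integral[OF cont])
qed

text \<open>In the geometric mean of \<open>jac z\<close> and \<open>jac (- z)\<close> the exponent \<open>a\<close> cancels.\<close>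

lemma jac_reflect_sum:
  assumes z: "cmod z \<le> 1 / 4"
  shows "2 * (15 / 17 / (1 + (cmod z)\<^sup>2)\<^sup>2) \<le> jac z + jac (- z)"
proof -
  define x y p q \<rho> where "x = cmod (1 + z)" and "y = cmod (1 - z)" and "p = cmod (1 + of_real lam * z)"
    and "q = cmod (1 - of_real lam * z)" and "\<rho> = cmod z"
  have z1: "cmod z < 1" using z by simp
  have pos: "0 < x" "0 < y" "0 < p" "0 < q"
    using Re_one_pm_pos[OF z1] Re_one_pm_pos(3,4)[OF norm_lam_z[OF z1]]
    by (simp_all add: x_def y_def p_def q_def del: right_minus_eq)
  \<comment> \<open>The product is |1 - z^2|; the same factorisation with
    \<open>of_real lam * z\<close> bounds \<open>p * q\<close>.\<close>
  have xy: "x * y \<le> 1 + \<rho>\<^sup>2"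
    using norm_one_pm_bounds(4)[of "z\<^sup>2"]
    by (simp add: x_def y_def \<rho>_def norm_power power2_eq_square algebra_simps flip: norm_mult)
  have lr: "(lam * \<rho>)\<^sup>2 \<le> 1 / 16"
  proof -
    have "lam * \<rho> \<le> 1 * (1 / 4)" using lam z by (intro mult_mono) (auto simp: \<rho>_def)
    then have "(lam * \<rho>)\<^sup>2 \<le> (1 / 4)\<^sup>2" using lam by (intro power_mono) (auto simp: \<rho>_def)
    then show ?thesis by (simp add: power2_eq_square)
  qed
  have pq: "p * q \<le> 17 / 16"
  proof -
    have "p * q = cmod (1 - (of_real lam * z)\<^sup>2)"
      by (simp add: p_def q_def power2_eq_square algebra_simps flip: norm_mult)
    also have "\<dots> \<le> 1 + (lam * \<rho>)\<^sup>2"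
      using norm_one_pm_bounds(4)[of "(of_real lam * z)\<^sup>2"] by (simp add: norm_mult norm_power \<rho>_def power_mult_distrib)
    finally show ?thesis using lr by simp
  qed
  \<comment> \<open>\<open>c\<close> is the geometric mean: in the product of the two Jacobians the
    powers of \<open>x * y\<close> differ by the exponent 4, whatever \<open>a\<close> is.\<close>
  define c where "c = (1 - lam\<^sup>2 * \<rho>\<^sup>2) / ((p * q) * (x * y)\<^sup>2)"
  have J: "jac z = (1 - lam\<^sup>2 * \<rho>\<^sup>2) * x powr (2 * (a - 1)) / (q\<^sup>2 * y powr (2 * (a + 1)))"
    "jac (- z) = (1 - lam\<^sup>2 * \<rho>\<^sup>2) * y powr (2 * (a - 1)) / (p\<^sup>2 * x powr (2 * (a + 1)))"
    by (simp_all add: jac_def x_def y_def p_def q_def \<rho>_def)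
  have shift: "v powr (2 * (a + 1)) = v powr (2 * (a - 1)) * v ^ 4" if "v > 0" for v
    using that powr_add[of v "2 * (a - 1)" 4] by (simp add: powr_numeral algebra_simps)
  have "jac z * jac (- z) = c\<^sup>2"
    unfolding J shift[OF pos(1)] shift[OF pos(2)] c_def using pos
    by (simp add: power_divide power_mult_distrib) (simp add: power2_eq_square)
  moreover have "0 \<le> jac z" "0 \<le> jac (- z)" using jac_nonneg[of z] jac_nonneg[of "- z"] z1 by auto
  ultimately have "2 * c \<le> jac z + jac (- z)"
    using arith_geo_mean[of c "jac z" "jac (- z)"] by simp
  moreover have "15 / 17 / (1 + \<rho>\<^sup>2)\<^sup>2 \<le> c"
  proof -
    \<comment> \<open>Since (lam rho)^2 is at most 1/16, the numerator of \<open>c\<close> is at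
      least 15/16 and \<open>p * q\<close> is at most 17/16.\<close>
    have "15 / 17 / (1 + \<rho>\<^sup>2)\<^sup>2 = (15 / 16) / ((17 / 16) * (1 + \<rho>\<^sup>2)\<^sup>2)" by simp
    also have "\<dots> \<le> c"
      unfolding c_def using pos lr xy pq
      by (intro frac_le mult_mono power_mono mult_pos_pos zero_less_power) (auto simp: power_mult_distrib)
    finally show ?thesis .
  qed
  ultimately show ?thesis by (simp add: \<rho>_def)
qed

section \<open>Lower area bounds beyond the discs of injectivity\<close>

lemma area_small_disc:
  assumes "0 \<le> s" "s \<le> 1 / 4" "inj_on f (ball 0 s)"
  shows "2 * pi * (15 / 17 * (s\<^sup>2 / (1 + s\<^sup>2) / 2)) \<le> area (f ` ball 0 s)"
proof -
  interpret P: planar_jacobian f "deriv h" "deriv g" "ball 0 s" jac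
    by (rule planar_jacobian_disc) (use assms in simp)
  let ?\<phi> = "\<lambda>x::real. 15 / 17 / (1 + x\<^sup>2)\<^sup>2"
  have nz: "1 + x\<^sup>2 \<noteq> 0" for x :: real by (smt (verit) zero_le_power2)
  have cont: "continuous_on {0..s} ?\<phi>"
    by (intro continuous_intros) (use nz in auto)
  \<comment> \<open>By symmetry the integral of \<open>jac\<close> is half that of
    \<open>jac z + jac (- z)\<close>, whose lower bound does not involve \<open>a\<close>.\<close>
  note r = lborel_reflect_disc[OF P.int]
  have "2 * (LINT z:ball (0::complex) s|lborel. ?\<phi> (cmod z)) = (LINT z:ball (0::complex) s|lborel. 2 * ?\<phi> (cmod z))"
    by (rule set_integral_mult_right[symmetric])
  also have "\<dots> \<le> (LINT z:ball 0 s|lborel. jac z + jac (- z))"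
  proof (rule set_integral_mono)
    show "set_integrable lborel (ball (0::complex) s) (\<lambda>z. 2 * ?\<phi> (cmod z))"
      using radial_integrable[OF cont] by (rule set_integrable_mult_right)
    show "set_integrable lborel (ball 0 s) (\<lambda>z. jac z + jac (- z))"
      using P.int r(1) by (rule set_integral_add(1))
  qed (use jac_reflect_sum assms in auto)
  also have "\<dots> = 2 * (LINT z:ball 0 s|lborel. jac z)"
    by (simp add: set_integral_add(2)[OF P.int r(1)] r(2))
  also have "(LINT z:ball 0 s|lborel. jac z) = area (f ` ball 0 s)"
    by (rule P.area_image_eq[OF assms(3), symmetric])
  finally have "2 * pi * integral {0..s} (\<lambda>x. x * ?\<phi> x) \<le> area (f ` ball 0 s)"
    unfolding radial_integral[OF cont] by simp
  also have "integral {0..s} (\<lambda>x. x * ?\<phi> x) = 15 / 17 * integral {0..s} (\<lambda>x. x / (1 + x\<^sup>2)\<^sup>2)"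
    by (subst integral_mult_right[symmetric]) (simp add: mult.commute)
  finally show ?thesis by (simp add: cauchy_kernel_integral[OF assms(1)])
qed

lemma area_mono:
  assumes "s \<le> r" "r < 1"
  shows "area (f ` ball 0 s) \<le> area (f ` ball 0 r)"
proof -
  interpret R: planar_jacobian f "deriv h" "deriv g" "ball 0 r" jac
    by (rule planar_jacobian_disc) (use assms in simp)
  interpret S: planar_jacobian f "deriv h" "deriv g" "ball 0 s" jac
    by (rule planar_jacobian_disc) (use assms in simp)
  \<comment> \<open>Real-valued \<open>measure\<close> is 0 on sets of infinite measure, so
    monotonicity needs a finite area. Continuity on the closed disc makes the image bounded.\<close>
  have "continuous_on (cball 0 r) f"
    by (rule has_derivative_continuous_on[OF has_derivative_at_withinI[OF f_has_derivative]])
       (use assms in simp)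
  then have "bounded (f ` cball 0 r)"
    by (intro compact_imp_bounded compact_continuous_image) auto
  then have "bounded (f ` ball 0 r)"
    by (rule bounded_subset) auto
  then have fin: "emeasure lborel (f ` ball 0 r) < \<infinity>"
    by (rule emeasure_bounded_finite)
  show ?thesis unfolding area_def
    by (rule measure_mono_fmeasurable) (use assms S.fS R.fS fin in \<open>auto simp: fmeasurable_def\<close>)
qed

lemma area_lower:
  assumes r: "0 < r" "r < 1"
  shows "2 * pi * integral {0..r} (\<lambda>x. x * lower_jac (max 1 \<bar>a\<bar>) x) \<le> area (f ` ball 0 r)"
proof (cases "\<bar>a\<bar> \<le> 2")
  case True
  show ?thesis by (rule area_lower_injective[OF r(2) inj_on_disc[OF True]]) (use r in simp)
next
  case False
  define b where "b = \<bar>a\<bar>"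
  define s where "s = 1 / (2 * b)"
  have b: "b > 2" "max 1 \<bar>a\<bar> = b" using False by (auto simp: b_def)
  have inj: "inj_on f (ball 0 s)" using inj_on_small_disc False by (simp add: s_def b_def)
  show ?thesis
  proof (cases "r \<le> s")
    case True
    then show ?thesis
      by (intro area_lower_injective[OF r(2)] inj_on_subset[OF inj]) auto
  next
    case rs: False
    have s: "0 < s" "s \<le> 1 / 4" using b by (simp_all add: s_def field_simps)
    \<comment> \<open>The factor containing \<open>lam\<close> is at most 1; without it the integral
      has an explicit primitive.\<close>
    have "integral {0..r} (\<lambda>x. x * lower_jac b x)
        \<le> integral {0..r} (\<lambda>x. x * ((1 - x) powr (2 * (b - 1)) / (1 + x) powr (2 * (b + 1))))"
    proof (rule integral_le)
      show "(\<lambda>x. x * lower_jac b x) integrable_on {0..r}"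
        by (intro integrable_continuous_real continuous_intros continuous_on_lower_jac r)
      show "(\<lambda>x. x * ((1 - x) powr (2 * (b - 1)) / (1 + x) powr (2 * (b + 1)))) integrable_on {0..r}"
        by (rule lower_kernel_integral(1)) (use b r in auto)
      fix x assume x: "x \<in> {0..r}"
      let ?K = "(1 - x) powr (2 * (b - 1)) / (1 + x) powr (2 * (b + 1))"
      have "(1 - lam\<^sup>2 * x\<^sup>2) / (1 + lam * x)\<^sup>2 \<le> 1 / 1"
        using lam_rho[of x] lam_mult_bounds[of x] x r by (intro frac_le) auto
      then have "(1 - lam\<^sup>2 * x\<^sup>2) / (1 + lam * x)\<^sup>2 * ?K \<le> 1 * ?K"
        by (intro mult_right_mono) auto
      then have "lower_jac b x \<le> ?K" by (simp add: lower_jac_def)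
      then show "x * lower_jac b x \<le> x * ?K" using x by (intro mult_left_mono) auto
    qed
    also have "\<dots> \<le> 1 / (4 * (4 * b\<^sup>2 - 1))"
      by (rule lower_kernel_integral(2)) (use b r in auto)
    \<comment> \<open>Both sides are of order 1/b^2. With s = 1/(2b), clearing denominators reduces
      the claim to 94 \<le> 104 b^2, which b > 2 ensures.\<close>
    also have "\<dots> \<le> 15 / 17 * (s\<^sup>2 / (1 + s\<^sup>2) / 2)"
    proof -
      have "s\<^sup>2 / (1 + s\<^sup>2) = 1 / (4 * b\<^sup>2 + 1)"
        using b by (simp add: s_def power_divide power_mult_distrib field_simps)
      moreover have "b\<^sup>2 \<ge> 2\<^sup>2" using b by (intro power_mono) auto
      then have "1 / (4 * (4 * b\<^sup>2 - 1)) \<le> 15 / 17 * (1 / (4 * b\<^sup>2 + 1) / 2)"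
        by (simp add: field_simps)
      ultimately show ?thesis by simp
    qed
    finally have "2 * pi * integral {0..r} (\<lambda>x. x * lower_jac b x) \<le> 2 * pi * (15 / 17 * (s\<^sup>2 / (1 + s\<^sup>2) / 2))"
      by (intro mult_left_mono) auto
    also have "\<dots> \<le> area (f ` ball 0 s)" using s by (intro area_small_disc inj) auto
    also have "\<dots> \<le> area (f ` ball 0 r)" using rs r by (intro area_mono) auto
    finally show ?thesis by (simp add: b)
  qed
qed

end

theorem theorem2p6:
  fixes a lam r :: real and h g f :: "complex \<Rightarrow> complex"
  assumes lam: "0 \<le> lam" "lam < 1"
    and hol: "h holomorphic_on ball 0 1" "g holomorphic_on ball 0 1"
    and h0: "h 0 = 0" and g0: "g 0 = 0"
    and hg: "\<And>z. z \<in> ball 0 1 \<Longrightarrow> h z - g z = kfun a z"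
    and dil: "\<And>z. z \<in> ball 0 1 \<Longrightarrow> deriv g z = (of_real lam * z) * deriv h z"
    and f: "\<And>z. f z = h z + cnj (g z)"
    and r: "0 < r" "r < 1"
  shows
   "(a \<ge> 1 \<longrightarrow>
      2 * pi * integral {0..r} (\<lambda>\<rho>. (\<rho> - lam^2 * \<rho>^3) * (1 - \<rho>) powr (2*(a-1))
            / ((1 + lam*\<rho>)^2 * (1 + \<rho>) powr (2*(a+1))))
        \<le> area (f ` ball 0 r) \<and>
      area (f ` ball 0 r) \<le>
      2 * pi * integral {0..r} (\<lambda>\<rho>. (\<rho> - lam^2 * \<rho>^3) * (1 + \<rho>) powr (2*(a-1))
            / ((1 - lam*\<rho>)^2 * (1 - \<rho>) powr (2*(a+1)))))
  \<and> (-1 < a \<and> a < 1 \<longrightarrow>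
      2 * pi * integral {0..r} (\<lambda>\<rho>. (\<rho> - lam^2 * \<rho>^3) / ((1 + lam*\<rho>)^2 * (1 + \<rho>)^4))
        \<le> area (f ` ball 0 r) \<and>
      area (f ` ball 0 r) \<le>
      2 * pi * integral {0..r} (\<lambda>\<rho>. (\<rho> - lam^2 * \<rho>^3) / ((1 - lam*\<rho>)^2 * (1 - \<rho>)^4)))
  \<and> (a \<le> -1 \<longrightarrow>
      2 * pi * integral {0..r} (\<lambda>\<rho>. (\<rho> - lam^2 * \<rho>^3) * (1 + \<rho>) powr (2*(a-1))
            / ((1 + lam*\<rho>)^2 * (1 - \<rho>) powr (2*(a+1))))
        \<le> area (f ` ball 0 r) \<and>
      area (f ` ball 0 r) \<le>
      2 * pi * integral {0..r} (\<lambda>\<rho>. (\<rho> - lam^2 * \<rho>^3) * (1 - \<rho>) powr (2*(a-1))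
            / ((1 - lam*\<rho>)^2 * (1 + \<rho>) powr (2*(a+1)))))"
proof -
  interpret sheared_kfun a lam h g f
    by standard (fact lam hol hg dil f)+
  note bounds = area_lower[OF r] area_upper[OF r(2)]
  have factor: "x - lam^2 * x^3 = x * (1 - lam\<^sup>2 * x\<^sup>2)" for x :: real
    by (simp add: power2_eq_square power3_eq_cube algebra_simps)
  show ?thesis
  proof (intro conjI impI)
    assume "a \<ge> 1"
    then have b: "max 1 \<bar>a\<bar> = a" by simp
    show "2 * pi * integral {0..r} (\<lambda>\<rho>. (\<rho> - lam^2 * \<rho>^3) * (1 - \<rho>) powr (2*(a-1))
            / ((1 + lam*\<rho>)^2 * (1 + \<rho>) powr (2*(a+1)))) \<le> area (f ` ball 0 r)"
      and "area (f ` ball 0 r) \<le> 2 * pi * integral {0..r} (\<lambda>\<rho>. (\<rho> - lam^2 * \<rho>^3) * (1 + \<rho>) powr (2*(a-1))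
            / ((1 - lam*\<rho>)^2 * (1 - \<rho>) powr (2*(a+1))))"
      using bounds unfolding b lower_jac_def upper_jac_def factor
      by (simp_all only: times_divide_eq_right mult.assoc)
  next
    assume "- 1 < a \<and> a < 1"
    then have b: "max 1 \<bar>a\<bar> = 1" by auto
    \<comment> \<open>For \<open>b = 1\<close> the exponents are 0 and 4, and \<open>r < 1\<close>
      keeps the bases positive, so \<open>powr\<close> reduces to ordinary powers.\<close>
    have "integral {0..r} (\<lambda>x. x * lower_jac 1 x)
        = integral {0..r} (\<lambda>\<rho>. (\<rho> - lam^2 * \<rho>^3) / ((1 + lam*\<rho>)^2 * (1 + \<rho>)^4))"
      using r by (intro integral_cong) (simp add: lower_jac_def factor powr_numeral)
    moreover have "integral {0..r} (\<lambda>x. x * upper_jac 1 x)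
        = integral {0..r} (\<lambda>\<rho>. (\<rho> - lam^2 * \<rho>^3) / ((1 - lam*\<rho>)^2 * (1 - \<rho>)^4))"
      using r by (intro integral_cong) (simp add: upper_jac_def factor powr_numeral)
    ultimately show "2 * pi * integral {0..r} (\<lambda>\<rho>. (\<rho> - lam^2 * \<rho>^3) / ((1 + lam*\<rho>)^2 * (1 + \<rho>)^4))
        \<le> area (f ` ball 0 r)"
      and "area (f ` ball 0 r) \<le>
        2 * pi * integral {0..r} (\<lambda>\<rho>. (\<rho> - lam^2 * \<rho>^3) / ((1 - lam*\<rho>)^2 * (1 - \<rho>)^4))"
      using bounds unfolding b by simp_all
  next
    assume "a \<le> - 1"
    then have b: "max 1 \<bar>a\<bar> = - a" by simp
    \<comment> \<open>Replacing \<open>b\<close> by \<open>- a\<close> negates the exponents, which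
      exchanges the powers in numerator and denominator.\<close>
    have flip: "x powr (2 * (- a - 1)) / (c * y powr (2 * (- a + 1))) = y powr (2 * (a - 1)) / (c * x powr (2 * (a + 1)))"
      for x y c :: real
    proof -
      have "2 * (- a - 1) = - (2 * (a + 1))" "2 * (- a + 1) = - (2 * (a - 1))" by simp_all
      then show ?thesis by (simp only: powr_minus_divide) simp
    qed
    have "integral {0..r} (\<lambda>x. x * lower_jac (- a) x)
        = integral {0..r} (\<lambda>\<rho>. (\<rho> - lam^2 * \<rho>^3) * (1 + \<rho>) powr (2*(a-1))
            / ((1 + lam*\<rho>)^2 * (1 - \<rho>) powr (2*(a+1))))"
      unfolding lower_jac_def factor
      by (intro integral_cong) (simp only: times_divide_eq_right[symmetric] mult.assoc flip)
    moreover have "integral {0..r} (\<lambda>x. x * upper_jac (- a) x)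
        = integral {0..r} (\<lambda>\<rho>. (\<rho> - lam^2 * \<rho>^3) * (1 - \<rho>) powr (2*(a-1))
            / ((1 - lam*\<rho>)^2 * (1 + \<rho>) powr (2*(a+1))))"
      unfolding upper_jac_def factor
      by (intro integral_cong) (simp only: times_divide_eq_right[symmetric] mult.assoc flip)
    ultimately show "2 * pi * integral {0..r} (\<lambda>\<rho>. (\<rho> - lam^2 * \<rho>^3) * (1 + \<rho>) powr (2*(a-1))
            / ((1 + lam*\<rho>)^2 * (1 - \<rho>) powr (2*(a+1)))) \<le> area (f ` ball 0 r)"
      and "area (f ` ball 0 r) \<le> 2 * pi * integral {0..r} (\<lambda>\<rho>. (\<rho> - lam^2 * \<rho>^3) * (1 - \<rho>) powr (2*(a-1))
            / ((1 - lam*\<rho>)^2 * (1 + \<rho>) powr (2*(a+1))))"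
      using bounds unfolding b by simp_all
  qed
qed

end
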